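(* For every $a\in\mathbb C^*$, we have $$(\zeta_r\circ\mathsf{Ev}_a)(E_n)=(\widetilde{\mathsf{ev}}_a\circ\zeta_{\triangle,r})(E_n)$$ in the $q$-Schur algebra $\mathcal S(n,r)$.
   Context: Throughout $q\in\mathbb C^*$ is not a root of unity, all algebras are over $\mathbb C$, $n\ge2$, $r\ge1$, $[x,y]_b=xy-byx$. **Double Ringel–Hall algebra.** Let $(c_{i,j})$ be the Cartan matrix of affine type $A$ with index set $I=\mathbb Z/n\mathbb Z=\{1,\dots,n\}$. $\mathfrak D(n)$ is generated by $E_i,F_i,K_i^{\pm1}$ ($i\in I$), $\mathsf z_s^+,\mathsf z_s^-$ ($s\ge1$), with relations: the $K_i$ commute and $K_iK_i^{-1}=1$; $K_iE_j=q^{\delta_{i,j}-\delta_{i,j+1}}E_jK_i$, $K_iF_j=q^{-\delta_{i,j}+\delta_{i,j+1}}F_jK_i$; $E_iF_j-F_jE_i=\delta_{i,j}\frac{\tilde K_i-\tilde K_i^{-1}}{q-q^{-1}}$ with $\tilde K_i=K_iK_{i+1}^{-1}$ (indices mod $n$); the quantum Serre relations $\sum_{b+c=1-c_{i,j}}(-1)^b\left[{1-c_{i,j}\atop b}\right]_qE_i^bE_jE_i^c=0$ for $i\ne j$ and the same for the $F$'s; all $\mathsf z_s^\pm$ are central. It is a Hopf algebra with $\Delta(E_i)=E_i\otimes\tilde K_i+1\otimes E_i$, $\Delta(F_i)=F_i\otimes1+\tilde K_i^{-1}\otimes F_i$, $\Delta(K_i)=K_i\otimes K_i$, $\Delta(\mathsf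 z_s^\pm)=\mathsf z_s^\pm\otimes1+1\otimes\mathsf z_s^\pm$. $U_\triangle(n)$ is the subalgebra generated by all $E_i,F_i,K_i^{\pm1}$ ($1\le i\le n$), and $U(n)$ (quantum $\mathfrak{gl}_n$) the subalgebra generated by $E_i,F_i$ ($1\le i<n$), $K_j^{\pm1}$ ($1\le j\le n$). **Tensor spaces and Schur algebras.** $\Omega$ has basis $\omega_s$ ($s\in\mathbb Z$), with $\mathfrak D(n)$-action $E_i\omega_s=\delta_{i+1,\bar s}\,\omega_{s-1}$, $F_i\omega_s=\delta_{i,\bar s}\,\omega_{s+1}$, $K_i^{\pm1}\omega_s=q^{\pm\delta_{i,\bar s}}\omega_s$, $\mathsf z_t^+\omega_s=\omega_{s-tn}$, $\mathsf z_t^-\omega_s=\omega_{s+tn}$ ($\bar s$ is $s$ mod $n$). $\Omega_n$ is the span of $\omega_1,\dots,\omega_n$, a $U(n)$-module. Let $\zeta_{\triangle,r}:\mathfrak D(n)\to\mathrm{End}(\Omega^{\otimes r})$ and $\zeta_r:U(n)\to\mathrm{End}(\Omega_n^{\otimes r})$ be the resulting homomorphisms; their images are the affine $q$-Schur algebra $\mathcal S_\triangle(n,r)$ and the $q$-Schur algebra $\mathcal S(n,r)$. **Hecke algebras.** $\mathcal H_\triangle(r)$ is generated by $T_1,\dots,T_{r-1}$, $X_1^{\pm1},\dots,X_r^{\pm1}$ with relations $(T_i+1)(T_i-q^2)=0$, braid relations for the $T_i$, $X_iX_j=X_jX_i$, $X_iX_i^{-1}=1$, $T_iX_iT_i=q^2X_{i+1}$,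 $X_jT_i=T_iX_j$ ($j\ne i,i+1$). $\mathcal H(r)$ is the subalgebra generated by the $T_i$. $\Omega^{\otimes r}$ is a right $\mathcal H_\triangle(r)$-module: $X_t^{-1}$ replaces $\omega_{i_t}$ by $\omega_{i_t+n}$ in $\omega_{\mathbf i}=\omega_{i_1}\otimes\cdots\otimes\omega_{i_r}$, and for $\mathbf i\in[1,n]^r$, $\omega_{\mathbf i}T_k=q^2\omega_{\mathbf i}$ if $i_k=i_{k+1}$, $q\omega_{\mathbf is_k}$ if $i_k<i_{k+1}$, $q\omega_{\mathbf is_k}+(q^2-1)\omega_{\mathbf i}$ if $i_{k+1}<i_k$ ($\mathbf is_k$ swaps entries $k,k+1$). One has $\mathcal S_\triangle(n,r)=\mathrm{End}_{\mathcal H_\triangle(r)}(\Omega^{\otimes r})$, $\mathcal S(n,r)=\mathrm{End}_{\mathcal H(r)}(\Omega_n^{\otimes r})$, and multiplication gives $\Omega^{\otimes r}\cong\Omega_n^{\otimes r}\otimes_{\mathcal H(r)}\mathcal H_\triangle(r)$. **Evaluation maps.** For $a\in\mathbb C^*$, $\mathsf{Ev}_a:U_\triangle(n)\to U(n)$ is the (known) algebra homomorphism with $E_i\mapsto E_i$, $F_i\mapsto F_i$ ($1\le i\le n-1$), $K_j\mapsto K_j$ ($1\le j\le n$), $E_n\mapsto aq^{-1}[F_{n-1},[F_{n-2},\cdots,[F_2,F_1]_{q^{-1}}\cdots]_{q^{-1}}]_{q^{-1}}K_1K_n$ and $F_n\mapsto a^{-1}q[\cdots[[E_1,E_2]_q,E_3]_q,\cdots,E_{n-1}]_q(K_1K_n)^{-1}$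 (for $n=2$ the iterated brackets are $F_1$, $E_1$). Moreover $\mathsf{ev}_a:\mathcal H_\triangle(r)\to\mathcal H(r)$ is the algebra homomorphism with $T_i\mapsto T_i$, $X_j\mapsto aq^{-2(j-1)}T_{j-1}\cdots T_2T_1T_1T_2\cdots T_{j-1}$; $\varepsilon_a:\Omega^{\otimes r}\to\Omega_n^{\otimes r}$ is $xh\mapsto x\cdot\mathsf{ev}_a(h)$ ($x\in\Omega_n^{\otimes r}$, $h\in\mathcal H_\triangle(r)$); and $\widetilde{\mathsf{ev}}_a:\mathcal S_\triangle(n,r)\to\mathcal S(n,r)$ is the algebra homomorphism $(\widetilde{\mathsf{ev}}_a(\varphi))(x)=\varepsilon_a(\varphi(x))$ for $x\in\Omega_n^{\otimes r}$. *)

theory Defs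
  imports
    Complex_Main
    "HOL-Library.Poly_Mapping"
    "HOL-Library.FuncSet"
    "HOL-Algebra.QuotRing"
    "HOL-Algebra.Subrings"
    "HOL-Algebra.Module"
begin

section \<open>Words and free associative algebras\<close>

text \<open>With concatenation as addition on words, the convolution product
  on finitely supported functions makes \<open>'a word \<Rightarrow>\<^sub>0 complex\<close> the free associative
  algebra on \<open>'a\<close>, which is also the tensor algebra of the vector space with basis \<open>'a\<close>
  (multiplication being the tensor product of vectors).\<close>

datatype 'a word = Word (letters: "'a list")

instantiation word :: (type) monoid_add
begin
definition zero_word :: "'a word" where "0 = Word []"
definition plus_word :: "'a word \<Rightarrow> 'a word \<Rightarrow> 'a word"
  where "u + v = Word (letters u @ letters v)"
instance by standard (simp_all add: zero_word_def plus_word_def)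
end

type_synonym 'a free = "'a word \<Rightarrow>\<^sub>0 complex"

definition cst :: "complex \<Rightarrow> 'a free" where "cst c = Poly_Mapping.single 0 c"

definition mon :: "'a list \<Rightarrow> 'a free" where "mon xs = Poly_Mapping.single (Word xs) 1"

abbreviation var :: "'a \<Rightarrow> 'a free" where "var x \<equiv> mon [x]"

definition lin_ext :: "('a list \<Rightarrow> 'b free) \<Rightarrow> 'a free \<Rightarrow> 'b free"
  where "lin_ext f v = (\<Sum>w\<in>Poly_Mapping.keys v. cst (Poly_Mapping.lookup v w) * f (letters w))"

section \<open>Complex algebras\<close>

text \<open>A complex algebra is a (possibly noncommutative) ring record with a scalar multiplication;
  the locale \<^locale>\<open>algebra\<close> of the library is restricted to commutative algebras.\<close>

type_synonym 'a calg = "(complex, 'a) module"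

definition free_alg :: "'a set \<Rightarrow> 'a free calg" where
  "free_alg G = \<lparr> carrier = {x. \<forall>w\<in>Poly_Mapping.keys x. set (letters w) \<subseteq> G},
     monoid.mult = times, one = 1, ring.zero = 0, add = (+), smult = (\<lambda>c x. cst c * x) \<rparr>"

text \<open>The algebra generated by \<open>G\<close> subject to \<open>x = 0\<close> for all \<open>x \<in> R\<close>. Its elements are
  cosets of the two-sided ideal generated by \<open>R\<close>.\<close>

definition presented :: "'a set \<Rightarrow> 'a free set \<Rightarrow> 'a free set calg" where
  "presented G R =
    (let A = free_alg G; I = Idl\<^bsub>A\<^esub> R; Q = A Quot I in
     \<lparr> carrier = carrier Q, monoid.mult = monoid.mult Q, one = one Q, ring.zero = ring.zero Q,
       add = add Q, smult = (\<lambda>c x. (I +>\<^bsub>A\<^esub> cst c) \<otimes>\<^bsub>Q\<^esub> x) \<rparr>)"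

definition pgen :: "'a set \<Rightarrow> 'a free set \<Rightarrow> 'a \<Rightarrow> 'a free set" where
  "pgen G R x = (Idl\<^bsub>free_alg G\<^esub> R) +>\<^bsub>free_alg G\<^esub> var x"

definition alg_hom :: "'a calg \<Rightarrow> 'b calg \<Rightarrow> ('a \<Rightarrow> 'b) set" where
  "alg_hom A B =
    {f \<in> ring_hom A B. \<forall>c. \<forall>x\<in>carrier A. f (c \<odot>\<^bsub>A\<^esub> x) = c \<odot>\<^bsub>B\<^esub> f x}"

definition is_subalgebra :: "'a set \<Rightarrow> 'a calg \<Rightarrow> bool" where
  "is_subalgebra B A \<longleftrightarrow> subring B A \<and> (\<forall>c. \<forall>x\<in>B. c \<odot>\<^bsub>A\<^esub> x \<in> B)"

definition generated_subalgebra :: "'a calg \<Rightarrow> 'a set \<Rightarrow> 'a calg" where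
  "generated_subalgebra A S = A\<lparr> carrier := \<Inter>{B. is_subalgebra B A \<and> S \<subseteq> B} \<rparr>"

definition alg_prod :: "'a calg \<Rightarrow> 'a list \<Rightarrow> 'a" where
  "alg_prod A xs = foldr (\<otimes>\<^bsub>A\<^esub>) xs \<one>\<^bsub>A\<^esub>"

definition qbracket :: "'a calg \<Rightarrow> complex \<Rightarrow> 'a \<Rightarrow> 'a \<Rightarrow> 'a" where
  "qbracket A b x y = (x \<otimes>\<^bsub>A\<^esub> y) \<ominus>\<^bsub>A\<^esub> (b \<odot>\<^bsub>A\<^esub> (y \<otimes>\<^bsub>A\<^esub> x))"

section \<open>Quantum integers and the Cartan matrix\<close>

definition qint :: "complex \<Rightarrow> nat \<Rightarrow> complex" where
  "qint q m = (q powi int m - q powi (- int m)) / (q - inverse q)"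

definition qfact :: "complex \<Rightarrow> nat \<Rightarrow> complex" where
  "qfact q m = (\<Prod>k=1..m. qint q k)"

definition qbinom :: "complex \<Rightarrow> nat \<Rightarrow> nat \<Rightarrow> complex" where
  "qbinom q m b = qfact q m / (qfact q b * qfact q (m - b))"

definition kd :: "nat \<Rightarrow> int \<Rightarrow> int \<Rightarrow> int" where
  "kd n i j = (if i mod int n = j mod int n then 1 else 0)"

text \<open>The representative in \<open>{1..n}\<close> of a residue class modulo \<open>n\<close>.\<close>

definition rep :: "nat \<Rightarrow> int \<Rightarrow> int" where "rep n i = (i - 1) mod int n + 1"

text \<open>For \<open>n = 2\<close> both off-diagonal terms contribute, giving the entries \<open>-2\<close> of
  affine type \<open>A\<close> of rank one.\<close>

definition cartan :: "nat \<Rightarrow> int \<Rightarrow> int \<Rightarrow> int" where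
  "cartan n i j = 2 * kd n i j - kd n i (j + 1) - kd n (i + 1) j"

section \<open>The double Ringel--Hall algebra\<close>

text \<open>\<open>GKi i\<close> stands for the inverse of \<open>K\<^sub>i\<close>, and \<open>GZp s\<close>, \<open>GZm s\<close> for
  \<open>z\<^sub>s\<^sup>+\<close>, \<open>z\<^sub>s\<^sup>-\<close>.\<close>

datatype dgen = GE int | GF int | GK int | GKi int | GZp nat | GZm nat

definition D_gens :: "nat \<Rightarrow> dgen set" where
  "D_gens n = (\<Union>i\<in>{1..int n}. {GE i, GF i, GK i, GKi i}) \<union> (\<Union>s\<in>{1..}. {GZp s, GZm s})"

definition serre :: "nat \<Rightarrow> complex \<Rightarrow> (int \<Rightarrow> dgen) \<Rightarrow> int \<Rightarrow> int \<Rightarrow> dgen free" where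
  "serre n q g i j = (let m = nat (1 - cartan n i j) in
     \<Sum>b\<le>m. cst ((-1) ^ b * qbinom q m b) * var (g i) ^ b * var (g j) * var (g i) ^ (m - b))"

definition D_rels :: "nat \<Rightarrow> complex \<Rightarrow> dgen free set" where
  "D_rels n q = (let N = {1..int n} in
     {var (GK i) * var (GK j) - var (GK j) * var (GK i) | i j. i \<in> N \<and> j \<in> N}
   \<union> {var (GK i) * var (GKi i) - 1 | i. i \<in> N}
   \<union> {var (GKi i) * var (GK i) - 1 | i. i \<in> N}
   \<union> {var (GK i) * var (GE j) - cst (q powi (kd n i j - kd n i (j + 1))) * var (GE j) * var (GK i)
       | i j. i \<in> N \<and> j \<in> N}
   \<union> {var (GK i) * var (GF j) - cst (q powi (- kd n i j + kd n i (j + 1))) * var (GF j) * var (GK i)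
       | i j. i \<in> N \<and> j \<in> N}
   \<union> {var (GE i) * var (GF j) - var (GF j) * var (GE i)
        - cst (of_int (kd n i j) / (q - inverse q)) *
          (var (GK i) * var (GKi (rep n (i + 1))) - var (GK (rep n (i + 1))) * var (GKi i))
       | i j. i \<in> N \<and> j \<in> N}
   \<union> {serre n q GE i j | i j. i \<in> N \<and> j \<in> N \<and> i \<noteq> j}
   \<union> {serre n q GF i j | i j. i \<in> N \<and> j \<in> N \<and> i \<noteq> j}
   \<union> {var (z s) * var g - var g * var (z s) | z s g. z \<in> {GZp, GZm} \<and> s \<ge> 1 \<and> g \<in> D_gens n})"

definition D_alg :: "nat \<Rightarrow> complex \<Rightarrow> dgen free set calg" where
  "D_alg n q = presented (D_gens n) (D_rels n q)"

abbreviation dg :: "nat \<Rightarrow> complex \<Rightarrow> dgen \<Rightarrow> dgen free set" where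
  "dg n q \<equiv> pgen (D_gens n) (D_rels n q)"

definition U_affine :: "nat \<Rightarrow> complex \<Rightarrow> dgen free set calg" where
  "U_affine n q = generated_subalgebra (D_alg n q)
     (dg n q ` (\<Union>i\<in>{1..int n}. {GE i, GF i, GK i, GKi i}))"

definition U_fin :: "nat \<Rightarrow> complex \<Rightarrow> dgen free set calg" where
  "U_fin n q = generated_subalgebra (D_alg n q)
     (dg n q ` ((\<Union>i\<in>{1..<int n}. {GE i, GF i}) \<union> (\<Union>j\<in>{1..int n}. {GK j, GKi j})))"

text \<open>The comultiplication on generators: a list of pairs \<open>(u, v)\<close> of words in the generators
  stands for the sum of the tensors \<open>u \<otimes> v\<close>.\<close>

primrec coprod :: "nat \<Rightarrow> dgen \<Rightarrow> (dgen list \<times> dgen list) list" where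
  "coprod n (GE i) = [([GE i], [GK i, GKi (rep n (i + 1))]), ([], [GE i])]"
| "coprod n (GF i) = [([GF i], []), ([GKi i, GK (rep n (i + 1))], [GF i])]"
| "coprod n (GK i) = [([GK i], [GK i])]"
| "coprod n (GKi i) = [([GKi i], [GKi i])]"
| "coprod n (GZp s) = [([GZp s], []), ([], [GZp s])]"
| "coprod n (GZm s) = [([GZm s], []), ([], [GZm s])]"

section \<open>Tensor spaces\<close>

text \<open>\<open>mon [i\<^sub>1, \<dots>, i\<^sub>r]\<close> is the basis vector \<open>\<omega>\<^bsub>i\<^sub>1\<^esub> \<otimes> \<dots> \<otimes> \<omega>\<^bsub>i\<^sub>r\<^esub>\<close> of \<open>\<Omega>\<^sup>\<otimes>\<^sup>r\<close>.\<close>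

type_synonym tensor = "int free"

definition Omega :: "nat \<Rightarrow> tensor set" where
  "Omega r = {x. \<forall>w\<in>Poly_Mapping.keys x. length (letters w) = r}"

definition Omega_fin :: "nat \<Rightarrow> nat \<Rightarrow> tensor set" where
  "Omega_fin n r =
    {x. \<forall>w\<in>Poly_Mapping.keys x. length (letters w) = r \<and> set (letters w) \<subseteq> {1..int n}}"

definition linear_maps :: "'a free set \<Rightarrow> 'b free set \<Rightarrow> ('a free \<Rightarrow> 'b free) set" where
  "linear_maps V W = {f \<in> V \<rightarrow>\<^sub>E W.
     (\<forall>x\<in>V. \<forall>y\<in>V. f (x + y) = f x + f y) \<and> (\<forall>c. \<forall>x\<in>V. f (cst c * x) = cst c * f x)}"

text \<open>Linear maps are extensional functions (undefined outside the given subspace), so that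
  equality in \<open>End_alg V\<close> is equality of operators on \<open>V\<close>.\<close>

definition End_alg :: "'a free set \<Rightarrow> ('a free \<Rightarrow> 'a free) calg" where
  "End_alg V = \<lparr> carrier = linear_maps V V, monoid.mult = compose V, one = (\<lambda>x\<in>V. x),
     ring.zero = (\<lambda>x\<in>V. 0), add = (\<lambda>f g. \<lambda>x\<in>V. f x + g x),
     smult = (\<lambda>c f. \<lambda>x\<in>V. cst c * f x) \<rparr>"

text \<open>The action of a generator on the basis vector \<open>\<omega>\<^sub>s\<close> of \<open>\<Omega>\<close>.\<close>

primrec omega_act :: "nat \<Rightarrow> complex \<Rightarrow> dgen \<Rightarrow> int \<Rightarrow> tensor" where
  "omega_act n q (GE i) s = cst (of_int (kd n (i + 1) s)) * mon [s - 1]"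
| "omega_act n q (GF i) s = cst (of_int (kd n i s)) * mon [s + 1]"
| "omega_act n q (GK i) s = cst (q powi kd n i s) * mon [s]"
| "omega_act n q (GKi i) s = cst (q powi (- kd n i s)) * mon [s]"
| "omega_act n q (GZp t) s = mon [s - int t * int n]"
| "omega_act n q (GZm t) s = mon [s + int t * int n]"

definition gen_act1 :: "nat \<Rightarrow> complex \<Rightarrow> dgen \<Rightarrow> tensor \<Rightarrow> tensor" where
  "gen_act1 n q g = lin_ext (\<lambda>w. omega_act n q g (hd w))"

text \<open>For operators \<open>f\<close> on \<open>\<Omega>\<close> and \<open>g\<close> on \<open>\<Omega>\<^sup>\<otimes>\<^sup>r\<close>, the operator \<open>f \<otimes> g\<close> on
  \<open>\<Omega> \<otimes> \<Omega>\<^sup>\<otimes>\<^sup>r\<close>.\<close>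

definition op_tensor :: "(tensor \<Rightarrow> tensor) \<Rightarrow> (tensor \<Rightarrow> tensor) \<Rightarrow> tensor \<Rightarrow> tensor" where
  "op_tensor f g = lin_ext (\<lambda>w. f (mon [hd w]) * g (mon (tl w)))"

definition word_op :: "(dgen \<Rightarrow> tensor \<Rightarrow> tensor) \<Rightarrow> dgen list \<Rightarrow> tensor \<Rightarrow> tensor" where
  "word_op \<rho> u = foldr (\<lambda>g f. \<rho> g \<circ> f) u id"

text \<open>\<open>gen_act n q r g\<close> is the action of the generator \<open>g\<close> on \<open>\<Omega>\<^sup>\<otimes>\<^sup>r\<close> through the iterated
  comultiplication. Only \<open>r \<ge> 1\<close> is meaningful; the equation for \<open>0\<close> is a dummy.\<close>

primrec gen_act :: "nat \<Rightarrow> complex \<Rightarrow> nat \<Rightarrow> dgen \<Rightarrow> tensor \<Rightarrow> tensor" where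
  "gen_act n q 0 = (\<lambda>g x. 0)"
| "gen_act n q (Suc r) =
    (if r = 0 then gen_act1 n q
     else (\<lambda>g x. \<Sum>(u, v)\<leftarrow>coprod n g.
             op_tensor (word_op (gen_act1 n q) u) (word_op (gen_act n q r) v) x))"

text \<open>\<open>\<zeta>\<close> is the representation of \<open>D(n)\<close> on \<open>\<Omega>\<^sup>\<otimes>\<^sup>r\<close>; a homomorphism is determined by its
  values on the generators.\<close>

definition is_zeta_affine ::
  "nat \<Rightarrow> complex \<Rightarrow> nat \<Rightarrow> (dgen free set \<Rightarrow> tensor \<Rightarrow> tensor) \<Rightarrow> bool" where
  "is_zeta_affine n q r \<zeta> \<longleftrightarrow>
     \<zeta> \<in> alg_hom (D_alg n q) (End_alg (Omega r)) \<and>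
     (\<forall>g\<in>D_gens n. \<zeta> (dg n q g) = restrict (gen_act n q r g) (Omega r))"

text \<open>\<open>\<Omega>\<^sub>n\<^sup>\<otimes>\<^sup>r\<close> is a \<open>U(n)\<close>-submodule of \<open>\<Omega>\<^sup>\<otimes>\<^sup>r\<close>, so \<open>\<zeta>\<^sub>r\<close> is obtained from the
  representation on \<open>\<Omega>\<^sup>\<otimes>\<^sup>r\<close> by restriction.\<close>

definition zeta_fin ::
  "nat \<Rightarrow> nat \<Rightarrow> (dgen free set \<Rightarrow> tensor \<Rightarrow> tensor) \<Rightarrow> dgen free set \<Rightarrow> tensor \<Rightarrow> tensor" where
  "zeta_fin n r \<zeta> u = restrict (\<zeta> u) (Omega_fin n r)"

definition schur_fin ::
  "nat \<Rightarrow> complex \<Rightarrow> nat \<Rightarrow> (dgen free set \<Rightarrow> tensor \<Rightarrow> tensor) \<Rightarrow> (tensor \<Rightarrow> tensor) set" where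
  "schur_fin n q r \<zeta> = zeta_fin n r \<zeta> ` carrier (U_fin n q)"

section \<open>Hecke algebras\<close>

text \<open>\<open>HXi j\<close> stands for the inverse of \<open>X\<^sub>j\<close>.\<close>

datatype hgen = HT nat | HX nat | HXi nat

definition H_gens :: "nat \<Rightarrow> hgen set" where
  "H_gens r = HT ` {1..<r} \<union> HX ` {1..r} \<union> HXi ` {1..r}"

definition H_rels :: "nat \<Rightarrow> complex \<Rightarrow> hgen free set" where
  "H_rels r q =
     {(var (HT i) + 1) * (var (HT i) - cst (q ^ 2)) | i. i \<in> {1..<r}}
   \<union> {var (HT i) * var (HT (i + 1)) * var (HT i) - var (HT (i + 1)) * var (HT i) * var (HT (i + 1))
       | i. i \<in> {1..<r} \<and> i + 1 \<in> {1..<r}}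
   \<union> {var (HT i) * var (HT j) - var (HT j) * var (HT i)
       | i j. i \<in> {1..<r} \<and> j \<in> {1..<r} \<and> i + 1 < j}
   \<union> {var (HX i) * var (HX j) - var (HX j) * var (HX i) | i j. i \<in> {1..r} \<and> j \<in> {1..r}}
   \<union> {var (HX i) * var (HXi i) - 1 | i. i \<in> {1..r}}
   \<union> {var (HXi i) * var (HX i) - 1 | i. i \<in> {1..r}}
   \<union> {var (HT i) * var (HX i) * var (HT i) - cst (q ^ 2) * var (HX (i + 1)) | i. i \<in> {1..<r}}
   \<union> {var (HX j) * var (HT i) - var (HT i) * var (HX j)
       | i j. i \<in> {1..<r} \<and> j \<in> {1..r} \<and> j \<noteq> i \<and> j \<noteq> i + 1}"

definition H_affine :: "nat \<Rightarrow> complex \<Rightarrow> hgen free set calg" where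
  "H_affine r q = presented (H_gens r) (H_rels r q)"

abbreviation hg :: "nat \<Rightarrow> complex \<Rightarrow> hgen \<Rightarrow> hgen free set" where
  "hg r q \<equiv> pgen (H_gens r) (H_rels r q)"

definition H_fin :: "nat \<Rightarrow> complex \<Rightarrow> hgen free set calg" where
  "H_fin r q = generated_subalgebra (H_affine r q) ((\<lambda>i. hg r q (HT i)) ` {1..<r})"

definition is_right_module :: "'a calg \<Rightarrow> 'b free set \<Rightarrow> ('b free \<Rightarrow> 'a \<Rightarrow> 'b free) \<Rightarrow> bool" where
  "is_right_module A V act \<longleftrightarrow>
     (\<forall>h\<in>carrier A. (\<lambda>x\<in>V. act x h) \<in> linear_maps V V) \<and>
     (\<forall>x\<in>V. \<forall>h\<in>carrier A. \<forall>k\<in>carrier A.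
        act x (h \<oplus>\<^bsub>A\<^esub> k) = act x h + act x k \<and> act x (h \<otimes>\<^bsub>A\<^esub> k) = act (act x h) k) \<and>
     (\<forall>x\<in>V. \<forall>h\<in>carrier A. \<forall>c. act x (c \<odot>\<^bsub>A\<^esub> h) = cst c * act x h) \<and>
     (\<forall>x\<in>V. act x \<one>\<^bsub>A\<^esub> = x)"

text \<open>List positions start at \<open>0\<close>, so the \<open>t\<close>-th tensor factor has index \<open>s ! (t - 1)\<close>.\<close>

definition swap_at :: "nat \<Rightarrow> 'a list \<Rightarrow> 'a list" where
  "swap_at k s = s[k - 1 := s ! k, k := s ! (k - 1)]"

definition T_act :: "complex \<Rightarrow> nat \<Rightarrow> int list \<Rightarrow> tensor" where
  "T_act q k s =
    (if s ! (k - 1) = s ! k then cst (q ^ 2) * mon s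
     else if s ! (k - 1) < s ! k then cst q * mon (swap_at k s)
     else cst q * mon (swap_at k s) + cst (q ^ 2 - 1) * mon s)"

text \<open>The values on \<open>X\<^sub>t\<^sup>-\<^sup>1\<close>, and on \<open>T\<^sub>k\<close> for indices in \<open>[1,n]\<^sup>r\<close>, determine the right module
  structure on all of \<open>\<Omega>\<^sup>\<otimes>\<^sup>r\<close>.\<close>

definition is_hecke_action ::
  "nat \<Rightarrow> complex \<Rightarrow> nat \<Rightarrow> (tensor \<Rightarrow> hgen free set \<Rightarrow> tensor) \<Rightarrow> bool" where
  "is_hecke_action n q r act \<longleftrightarrow>
     is_right_module (H_affine r q) (Omega r) act \<and>
     (\<forall>s t. length s = r \<and> t \<in> {1..r} \<longrightarrow>
        act (mon s) (hg r q (HXi t)) = mon (s[t - 1 := s ! (t - 1) + int n])) \<and>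
     (\<forall>s k. length s = r \<and> set s \<subseteq> {1..int n} \<and> k \<in> {1..<r} \<longrightarrow>
        act (mon s) (hg r q (HT k)) = T_act q k s)"

section \<open>Evaluation maps\<close>

text \<open>\<open>nested_F n q k\<close> is \<open>[F\<^bsub>k+1\<^esub>, [F\<^sub>k, \<dots>, [F\<^sub>2, F\<^sub>1] \<dots>]]\<close> with parameter \<open>q\<^sup>-\<^sup>1\<close>, and
  \<open>nested_E n q k\<close> is \<open>[\<dots> [[E\<^sub>1, E\<^sub>2], E\<^sub>3], \<dots>, E\<^bsub>k+1\<^esub>]\<close> with parameter \<open>q\<close>.\<close>

primrec nested_F :: "nat \<Rightarrow> complex \<Rightarrow> nat \<Rightarrow> dgen free set" where
  "nested_F n q 0 = dg n q (GF 1)"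
| "nested_F n q (Suc k) =
     qbracket (D_alg n q) (inverse q) (dg n q (GF (int k + 2))) (nested_F n q k)"

primrec nested_E :: "nat \<Rightarrow> complex \<Rightarrow> nat \<Rightarrow> dgen free set" where
  "nested_E n q 0 = dg n q (GE 1)"
| "nested_E n q (Suc k) =
     qbracket (D_alg n q) q (nested_E n q k) (dg n q (GE (int k + 2)))"

definition is_Ev ::
  "nat \<Rightarrow> complex \<Rightarrow> complex \<Rightarrow> (dgen free set \<Rightarrow> dgen free set) \<Rightarrow> bool" where
  "is_Ev n q a Ev \<longleftrightarrow> (let D = D_alg n q; N = int n in
     Ev \<in> alg_hom (U_affine n q) (U_fin n q) \<and>
     (\<forall>i\<in>{1..<N}. Ev (dg n q (GE i)) = dg n q (GE i) \<and> Ev (dg n q (GF i)) = dg n q (GF i)) \<and>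
     (\<forall>j\<in>{1..N}. Ev (dg n q (GK j)) = dg n q (GK j)) \<and>
     Ev (dg n q (GE N)) = (a * inverse q) \<odot>\<^bsub>D\<^esub>
       alg_prod D [nested_F n q (n - 2), dg n q (GK 1), dg n q (GK N)] \<and>
     Ev (dg n q (GF N)) = (inverse a * q) \<odot>\<^bsub>D\<^esub>
       alg_prod D [nested_E n q (n - 2), dg n q (GKi N), dg n q (GKi 1)])"

definition is_ev :: "nat \<Rightarrow> complex \<Rightarrow> complex \<Rightarrow> (hgen free set \<Rightarrow> hgen free set) \<Rightarrow> bool" where
  "is_ev r q a ev \<longleftrightarrow> (let H = H_affine r q; T = (\<lambda>i. hg r q (HT i)) in
     ev \<in> alg_hom H (H_fin r q) \<and>
     (\<forall>i\<in>{1..<r}. ev (T i) = T i) \<and>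
     (\<forall>j\<in>{1..r}. ev (hg r q (HX j)) =
        (a * q powi (- 2 * (int j - 1))) \<odot>\<^bsub>H\<^esub>
          alg_prod H (map T (rev [1..<j]) @ map T [1..<j])))"

definition is_eps ::
  "nat \<Rightarrow> complex \<Rightarrow> nat \<Rightarrow> (tensor \<Rightarrow> hgen free set \<Rightarrow> tensor) \<Rightarrow>
   (hgen free set \<Rightarrow> hgen free set) \<Rightarrow> (tensor \<Rightarrow> tensor) \<Rightarrow> bool" where
  "is_eps n q r act ev \<epsilon> \<longleftrightarrow>
     \<epsilon> \<in> linear_maps (Omega r) (Omega_fin n r) \<and>
     (\<forall>x\<in>Omega_fin n r. \<forall>h\<in>carrier (H_affine r q). \<epsilon> (act x h) = act x (ev h))"

definition ev_tilde ::
  "nat \<Rightarrow> nat \<Rightarrow> (tensor \<Rightarrow> tensor) \<Rightarrow> (tensor \<Rightarrow> tensor) \<Rightarrow> tensor \<Rightarrow> tensor" where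
  "ev_tilde n r \<epsilon> \<phi> = (\<lambda>x\<in>Omega_fin n r. \<epsilon> (\<phi> x))"

end

theory Submission
  imports Defs
begin

text \<open>
  Both sides are linear operators on \<open>\<Omega>\<^sub>n\<^sup>\<otimes>\<^sup>r\<close>, so it suffices to compare them on a word \<open>w\<close> with
  letters in \<open>1, \<dots>, n\<close>. Write \<open>#i(w)\<close> for the number of letters \<open>i\<close> in \<open>w\<close>.

  On the side of the quantum group, the iterated bracket of \<open>F\<^sub>1, \<dots>, F\<^bsub>n-1\<^esub>\<close> is a root vector,
  whose operator \<open>root_op q 1 n\<close> satisfies a simple recursion in the first letter of \<open>w\<close>, because
  the coproduct of a root vector involves only root vectors and the \<open>K\<^sub>i\<close> (\<open>root_op_step\<close>,
  \<open>zeta_nested_F\<close>). So the left-hand side is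
  \<open>a q\<^sup>-\<^sup>1 q\<^bsup>#1(w) + #n(w)\<^esup> root_vec q 1 n w\<close>.

  On the side of the Hecke algebra, \<open>E\<^sub>n\<close> replaces a letter \<open>1\<close> of \<open>w = u 1 v\<close> by \<open>0\<close>, and
  \<open>\<omega>\<^sub>0 = \<omega>\<^sub>n X\<close>. Evaluation turns \<open>X\<close> into a multiple of \<open>T\<^bsub>t-1\<^esub>\<dots>T\<^sub>1T\<^sub>1\<dots>T\<^bsub>t-1\<^esub>\<close>, where \<open>t\<close> is the
  position of the letter. The first half moves the letter \<open>n\<close> to the front, only contributing a
  scalar since \<open>n\<close> is the largest letter; the second half carries it back through \<open>u\<close>, and the result
  \<open>carry q n u\<close> again satisfies a recursion in the first letter
  (\<open>fold_T_op_evaluated_X\<close>). So the right-hand side is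
  \<open>a q\<^bsup>#n(w)\<^esup>\<close> times the sum of \<open>q\<^bsup>-#1(v)-|u|\<^esup> carry q n u \<cdot> v\<close> over all factorizations
  \<open>w = u 1 v\<close>, which is \<open>carry_sum q 1 n w\<close>.

  It remains to see that \<open>q\<^bsup>#1(w)\<^esup> root_vec q 1 n w = q carry_sum q 1 n w\<close>. With
  \<open>n\<close> replaced by an arbitrary letter \<open>j > 1\<close> this follows by induction on \<open>w\<close>: the two recursions
  agree (\<open>root_vec_eq_carry_sum\<close>). The only case that is not literal is a
  first letter \<open>1\<close>, where a geometric sum has to be evaluated.

  The remaining part of the theory realizes this inside the presented algebras: the quotients are
  rings, generators act as prescribed, and homomorphisms can be evaluated on brackets and products.
\<close>

section \<open>Linear combinations of words\<close>

lemma lookup_cst_mult [simp]: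
  "Poly_Mapping.lookup (cst c * x) w = c * Poly_Mapping.lookup x w"
  unfolding cst_def mult_map_scale_conv_mult[symmetric] by (simp add: Poly_Mapping.map.rep_eq when_def)

lemma lookup_mon: "Poly_Mapping.lookup (mon u) w = (if w = Word u then 1 else 0)"
  by (auto simp: mon_def lookup_single)

lemma mon_append: "mon (u @ v) = mon u * mon v"
  by (simp add: mon_def mult_single plus_word_def)

lemma mon_Cons: "mon (x # v) = var x * mon v"
  using mon_append[of "[x]" v] by simp

lemma mon_Nil [simp]: "mon [] = 1"
  by (simp add: mon_def zero_word_def flip: single_one)

lemma cst_0 [simp]: "cst 0 = 0" and cst_1 [simp]: "cst 1 = 1"
  by (simp_all add: cst_def)

lemma cst_mult: "cst (c * d) = cst c * cst d"
  by (simp add: cst_def mult_single)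

lemma cst_cst_mult: "cst c * (cst d * x) = cst (c * d) * x"
  by (simp add: cst_mult mult.assoc)

lemma cst_add: "cst (c + d) = cst c + cst d"
  by (simp add: cst_def single_add)

text \<open>Everything below compares operators on words only; this expansion and the induction rule
  \<open>span_words_induct\<close> derived from it are what makes that enough.\<close>

lemma word_expansion:
  "x = (\<Sum>w\<in>Poly_Mapping.keys x. cst (Poly_Mapping.lookup x w) * mon (letters w))"
proof (rule poly_mapping_eqI)
  fix v
  have "Poly_Mapping.lookup x v = (\<Sum>w\<in>Poly_Mapping.keys x. if v = w then Poly_Mapping.lookup x w else 0)"
    by (auto simp: in_keys_iff)
  then show "Poly_Mapping.lookup x v = Poly_Mapping.lookup
      (\<Sum>w\<in>Poly_Mapping.keys x. cst (Poly_Mapping.lookup x w) * mon (letters w)) v"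
    by (simp add: lookup_sum lookup_mon if_distrib cong: if_cong)
qed

lemma cst_commute: "x * cst c = cst c * x"
proof -
  have "mon u * cst c = cst c * mon u" for u :: "'a list"
    by (simp add: mon_def cst_def mult_single)
  then have "cst d * mon u * cst c = cst c * (cst d * mon u)" for d and u :: "'a list"
    by (simp add: mult.assoc) (simp add: mult.commute flip: mult.assoc cst_mult)
  then have "(\<Sum>w\<in>Poly_Mapping.keys x. cst (Poly_Mapping.lookup x w) * mon (letters w)) * cst c
      = cst c * (\<Sum>w\<in>Poly_Mapping.keys x. cst (Poly_Mapping.lookup x w) * mon (letters w))"
    by (simp add: sum_distrib_left sum_distrib_right)
  then show ?thesis by (simp flip: word_expansion)
qed

lemma mult_cst_left: "x * (cst c * y) = cst c * (x * y)"
  by (simp add: cst_commute flip: mult.assoc)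

text \<open>The carrier of a free algebra, \<open>\<Omega>\<^sup>\<otimes>\<^sup>r\<close> and \<open>\<Omega>\<^sub>n\<^sup>\<otimes>\<^sup>r\<close> are all of this form, for
  different sets of words.\<close>

definition span_words :: "'a list set \<Rightarrow> 'a free set" where
  "span_words W = {x. \<forall>w\<in>Poly_Mapping.keys x. letters w \<in> W}"

lemma span_words_zero [simp]: "0 \<in> span_words W"
  by (simp add: span_words_def)

lemma span_words_mon [simp]: "mon u \<in> span_words W \<longleftrightarrow> u \<in> W"
  by (simp add: span_words_def mon_def)

lemma span_words_add: "x \<in> span_words W \<Longrightarrow> y \<in> span_words W \<Longrightarrow> x + y \<in> span_words W"
  unfolding span_words_def using keys_add[of x y] by blast

lemma span_words_cst_mult: "x \<in> span_words W \<Longrightarrow> cst c * x \<in> span_words W"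
  by (auto simp: span_words_def in_keys_iff)

lemma span_words_uminus: "x \<in> span_words W \<Longrightarrow> - x \<in> span_words W"
  by (auto simp: span_words_def in_keys_iff)

lemma span_words_diff: "x \<in> span_words W \<Longrightarrow> y \<in> span_words W \<Longrightarrow> x - y \<in> span_words W"
  using span_words_add[OF _ span_words_uminus, of x W y] by simp

lemma span_words_sum: "(\<And>i. i \<in> I \<Longrightarrow> f i \<in> span_words W) \<Longrightarrow> sum f I \<in> span_words W"
  by (induction I rule: infinite_finite_induct) (auto intro: span_words_add)

lemma span_words_mult:
  assumes "x \<in> span_words U" "y \<in> span_words V" "\<And>u v. u \<in> U \<Longrightarrow> v \<in> V \<Longrightarrow> u @ v \<in> W"
  shows "x * y \<in> span_words W"
  using keys_mult[of x y] assms unfolding span_words_def by (force simp: plus_word_def)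

lemma span_words_induct [consumes 1, case_names zero word add scale]:
  assumes "x \<in> span_words W"
    and "P 0" and word: "\<And>w. w \<in> W \<Longrightarrow> P (mon w)"
    and add: "\<And>x y. x \<in> span_words W \<Longrightarrow> y \<in> span_words W \<Longrightarrow> P x \<Longrightarrow> P y \<Longrightarrow> P (x + y)"
    and scale: "\<And>c x. x \<in> span_words W \<Longrightarrow> P x \<Longrightarrow> P (cst c * x)"
  shows "P x"
proof -
  let ?term = "\<lambda>w. cst (Poly_Mapping.lookup x w) * mon (letters w)"
  have "letters w \<in> W" if "w \<in> Poly_Mapping.keys x" for w
    using that assms(1) by (simp add: span_words_def)
  then have summand: "?term w \<in> span_words W" "P (?term w)" if "w \<in> Poly_Mapping.keys x" for w
    using that by (simp_all add: scale word span_words_cst_mult)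
  have "P (sum ?term I) \<and> sum ?term I \<in> span_words W" if "I \<subseteq> Poly_Mapping.keys x" for I
    using that
  proof (induction I rule: infinite_finite_induct)
    case (insert w I)
    then show ?case by (simp add: add summand span_words_add)
  qed (simp_all add: assms(2))
  then show ?thesis by (metis order_refl word_expansion)
qed

definition linear_op :: "('a free \<Rightarrow> 'b free) \<Rightarrow> bool" where
  "linear_op f \<longleftrightarrow> (\<forall>x y. f (x + y) = f x + f y) \<and> (\<forall>c x. f (cst c * x) = cst c * f x)"

lemma linear_op_add: "linear_op f \<Longrightarrow> f (x + y) = f x + f y"
  and linear_op_scale: "linear_op f \<Longrightarrow> f (cst c * x) = cst c * f x"
  by (simp_all add: linear_op_def)

lemma linear_op_zero: "linear_op f \<Longrightarrow> f 0 = 0"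
  using linear_op_scale[of f 0 0] by simp

lemma linear_op_eqI:
  assumes "linear_op f" "linear_op g" "\<And>w. f (mon w) = g (mon w)"
  shows "f x = g x"
proof -
  have "x \<in> span_words UNIV" by (simp add: span_words_def)
  then show ?thesis
    by (induction rule: span_words_induct) (use assms in \<open>simp_all add: linear_op_zero linear_op_add linear_op_scale\<close>)
qed

lemma linear_op_lin_ext [simp]: "linear_op (lin_ext f)"
proof -
  have eq: "lin_ext f x = (\<Sum>w\<in>A. cst (Poly_Mapping.lookup x w) * f (letters w))"
    if "finite A" "Poly_Mapping.keys x \<subseteq> A" for A x
    unfolding lin_ext_def by (rule sum.mono_neutral_left) (use that in \<open>auto simp: in_keys_iff\<close>)
  have "lin_ext f (x + y) = lin_ext f x + lin_ext f y" for x y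
    using Poly_Mapping.keys_add[of x y]
    by (simp add: eq[of "Poly_Mapping.keys x \<union> Poly_Mapping.keys y"] lookup_add cst_add
        distrib_right sum.distrib)
  moreover have "lin_ext f (cst c * x) = cst c * lin_ext f x" for c x
    by (subst (1 2) eq[of "Poly_Mapping.keys x"])
      (auto simp: cst_mult sum_distrib_left mult.assoc in_keys_iff)
  ultimately show ?thesis by (simp add: linear_op_def)
qed

lemma lin_ext_mon [simp]: "lin_ext f (mon w) = f w"
  by (simp add: lin_ext_def mon_def)

lemmas lin_ext_add = linear_op_add[OF linear_op_lin_ext]
  and lin_ext_scale = linear_op_scale[OF linear_op_lin_ext]
  and lin_ext_zero [simp] = linear_op_zero[OF linear_op_lin_ext]

lemma lin_ext_in_span_words:
  "(\<And>w. w \<in> W \<Longrightarrow> f w \<in> span_words V) \<Longrightarrow> x \<in> span_words W \<Longrightarrow> lin_ext f x \<in> span_words V"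
  unfolding lin_ext_def
  by (intro span_words_sum span_words_cst_mult) (simp add: span_words_def[of W])

section \<open>Root vectors acting on the tensor space\<close>

lemma linear_op_plus: "linear_op f \<Longrightarrow> linear_op g \<Longrightarrow> linear_op (\<lambda>x. f x + g x)"
  by (simp add: linear_op_def algebra_simps)

lemma linear_op_mult: "linear_op f \<Longrightarrow> linear_op (\<lambda>x. y * f x)"
  by (simp add: linear_op_def distrib_left mult_cst_left)

lemma linear_op_compose: "linear_op f \<Longrightarrow> linear_op g \<Longrightarrow> linear_op (\<lambda>x. f (g x))"
  by (simp add: linear_op_def)

lemma linear_op_id: "linear_op (\<lambda>x. x)"
  by (simp add: linear_op_def)

lemma lin_ext_one [simp]: "lin_ext f 1 = f []"
  using lin_ext_mon[of f "[]"] by simp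

lemmas linear_op_intros = linear_op_plus linear_op_mult linear_op_compose[OF linear_op_lin_ext]
  linear_op_id linear_op_lin_ext

text \<open>The action on words of the root vector
  \<open>F\<^bsub>[i,j)\<^esub> = [F\<^bsub>j-1\<^esub>, [F\<^bsub>j-2\<^esub>, \<dots>, F\<^sub>i]]\<close> (brackets with parameter \<open>q\<^sup>-\<^sup>1\<close>), which turns a letter
  \<open>i\<close> into \<open>j\<close>. By the definition of \<open>\<Delta>(F\<^sub>k)\<close> and induction on \<open>j - i\<close>,
  \<open>\<Delta>(F\<^bsub>[i,j)\<^esub>)\<close> is
  \<open>F\<^bsub>[i,j)\<^esub> \<otimes> 1 + K\<^sub>i\<^sup>-\<^sup>1K\<^sub>j \<otimes> F\<^bsub>[i,j)\<^esub> + (1 - q\<^sup>-\<^sup>2) \<Sum> F\<^bsub>[x,j)\<^esub> K\<^sub>i\<^sup>-\<^sup>1K\<^sub>x \<otimes> F\<^bsub>[i,x)\<^esub>\<close>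
  with the sum over \<open>i < x < j\<close>. In the first tensor factor \<open>F\<^bsub>[x,j)\<^esub> K\<^sub>i\<^sup>-\<^sup>1K\<^sub>x\<close>
  only sees \<open>\<omega>\<^sub>x\<close> and sends it to \<open>q \<omega>\<^sub>j\<close>, so peeling off the first letter gives the recursion
  below, with one term for each of the three parts of the coproduct. Taking this recursion as the
  definition avoids expanding the iterated brackets.\<close>

fun root_vec :: "complex \<Rightarrow> int \<Rightarrow> int \<Rightarrow> int list \<Rightarrow> tensor" where
  "root_vec q i j [] = 0"
| "root_vec q i j (x # w) =
     cst (if x = i then 1 else 0) * mon (j # w)
   + cst (if x = i then inverse q else if x = j then q else 1) * (var x * root_vec q i j w)
   + cst (if i < x \<and> x < j then q - inverse q else 0) * (var j * root_vec q i x w)"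

abbreviation root_op :: "complex \<Rightarrow> int \<Rightarrow> int \<Rightarrow> tensor \<Rightarrow> tensor" where
  "root_op q i j \<equiv> lin_ext (root_vec q i j)"

lemma root_op_var_mult:
  "root_op q i j (var x * v) =
     cst (if x = i then 1 else 0) * (var j * v)
   + cst (if x = i then inverse q else if x = j then q else 1) * (var x * root_op q i j v)
   + cst (if i < x \<and> x < j then q - inverse q else 0) * (var j * root_op q i x v)"
  by (rule linear_op_eqI[of "\<lambda>v. root_op q i j (var x * v)"])
    (auto intro!: linear_op_intros simp flip: mon_Cons)

lemmas var_mult_cst = mult_cst_left[of "var _"]

lemma simple_root_op_var_mult:
  "root_op q k (k + 1) (var x * v) =
     cst (if x = k then 1 else 0) * (var (k + 1) * v)
   + cst (if x = k then inverse q else if x = k + 1 then q else 1) * (var x * root_op q k (k + 1) v)"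
proof -
  have "\<not> (k < x \<and> x < k + 1)" by simp
  then show ?thesis by (simp only: root_op_var_mult if_False cst_0 mult_zero_left add_0_right)
qed

lemma root_op_var_mult_above:
  "i < j \<Longrightarrow> j < x \<Longrightarrow> root_op q i j (var x * v) = var x * root_op q i j v"
  by (simp add: root_op_var_mult)

text \<open>The operators of \<open>F\<^sub>k\<close> and \<open>F\<^bsub>[i,j)\<^esub>\<close> commute for \<open>j < k\<close>. A first letter below \<open>k\<close> is
  invisible to \<open>F\<^sub>k\<close>, and so is \<open>j\<close>; a first letter \<open>x \<ge> k\<close> and its image \<open>k + 1\<close> lie above \<open>j\<close> and
  are invisible to \<open>F\<^bsub>[i,j)\<^esub>\<close>.\<close>

lemma root_op_commute:
  assumes "i < j" and "j < k"
  shows "root_op q k (k + 1) (root_op q i j v) = root_op q i j (root_op q k (k + 1) v)"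
proof (rule linear_op_eqI[of "\<lambda>v. root_op q k (k + 1) (root_op q i j v)"])
  fix w
  show "root_op q k (k + 1) (root_op q i j (mon w)) = root_op q i j (root_op q k (k + 1) (mon w))"
    using \<open>i < j\<close> \<open>j < k\<close>
  proof (induction w arbitrary: j)
    case Nil
    then show ?case by simp
  next
    case (Cons x w)
    show ?case
    proof (cases "x < k")
      case True
      have below: "root_op q k (k + 1) (var y * v) = var y * root_op q k (k + 1) v" if "y < k" for y v
        using that by (simp add: simple_root_op_var_mult)
      have "cst (if i < x \<and> x < j then q - inverse q else 0)
            * (var j * root_op q k (k + 1) (root_op q i x (mon w)))
          = cst (if i < x \<and> x < j then q - inverse q else 0)
            * (var j * root_op q i x (root_op q k (k + 1) (mon w)))"
        using Cons.IH[of x] Cons.prems by simp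
      then show ?thesis
        unfolding mon_Cons[of x w] root_op_var_mult[of q i j] below[OF True] lin_ext_add lin_ext_scale
          below[OF \<open>j < k\<close>] Cons.IH[OF Cons.prems]
        by simp
    next
      case False
      then have "j < x" "j < k + 1" using Cons.prems by simp_all
      then show ?thesis
        unfolding mon_Cons[of x w] simple_root_op_var_mult lin_ext_add lin_ext_scale
          root_op_var_mult_above[OF \<open>i < j\<close> \<open>j < x\<close>] root_op_var_mult_above[OF \<open>i < j\<close> \<open>j < k + 1\<close>]
          Cons.IH[OF Cons.prems] by simp
    qed
  qed
qed (simp_all add: linear_op_def lin_ext_add lin_ext_scale)

text \<open>This identity ties \<open>root_vec\<close> to the nested brackets. Comparing the two
  sides on a word with first letter \<open>x\<close>, the terms with \<open>F\<^sub>k\<close> on a letter \<open>k\<close> in front and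
  \<open>F\<^bsub>[i,k)\<^esub>\<close> on the rest get the weight \<open>q\<close> in one product and \<open>q\<^sup>-\<^sup>1\<close> in the other, which
  leaves the summand with coefficient \<open>q - q\<^sup>-\<^sup>1\<close> for \<open>x = k\<close>. For \<open>i < x < k\<close> one needs that \<open>F\<^sub>k\<close> commutes with \<open>F\<^bsub>[i,x)\<^esub>\<close>.\<close>

lemma root_op_step:
  assumes "q \<noteq> 0" and "i < k"
  shows "root_op q i (k + 1) v = root_op q k (k + 1) (root_op q i k v)
    - cst (inverse q) * root_op q i k (root_op q k (k + 1) v)"
proof (rule linear_op_eqI[of "root_op q i (k + 1)"
      "\<lambda>v. root_op q k (k + 1) (root_op q i k v) - cst (inverse q) * root_op q i k (root_op q k (k + 1) v)"])
  fix w
  show "root_op q i (k + 1) (mon w) = root_op q k (k + 1) (root_op q i k (mon w))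
    - cst (inverse q) * root_op q i k (root_op q k (k + 1) (mon w))"
  proof (induction w)
    case Nil
    then show ?case by simp
  next
    case (Cons x w)
    have com: "root_op q k (k + 1) (root_op q i x (mon w)) = root_op q i x (root_op q k (k + 1) (mon w))"
      if "i < x" "x < k" using that by (rule root_op_commute)
    note IH = Cons.IH[unfolded lin_ext_mon]
    consider "x < i" | "x = i" | "i < x" "x < k" | "x = k" | "x = k + 1" | "k + 1 < x"
      by linarith
    then show ?case
      by cases (use \<open>q \<noteq> 0\<close> \<open>i < k\<close> com in \<open>simp_all add: mon_Cons[of x w] mon_Cons[of k w]
        mon_Cons[of i w] mon_Cons[of "k + 1" w]
        root_op_var_mult lin_ext_add lin_ext_scale var_mult_cst IH distrib_left right_diff_distrib\<close>,
        (rule poly_mapping_eqI, simp add: lookup_add lookup_minus field_simps)+)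
  qed
qed (simp_all add: linear_op_def lin_ext_add lin_ext_scale algebra_simps mult_cst_left[of "cst (inverse q)"])

section \<open>Moving a letter through a word in the Hecke algebra\<close>

text \<open>The vector \<open>\<omega>\<^sub>j\<omega>\<^sub>u T\<^sub>1T\<^sub>2\<dots>T\<^sub>m\<close> with \<open>m\<close> the length of \<open>u\<close> (see \<open>fold_T_op_ascending\<close>). The
  letter in hand moves to the right; when it meets a smaller letter \<open>y\<close>, the quadratic term of
  \<open>T\<^sub>k\<close> allows it to stay, and then \<open>y\<close> is carried on in its place.\<close>

fun carry :: "complex \<Rightarrow> int \<Rightarrow> int list \<Rightarrow> tensor" where
  "carry q j [] = var j"
| "carry q j (y # u) = cst (if y = j then q ^ 2 else q) * (var y * carry q j u)
     + cst (if y < j then q ^ 2 - 1 else 0) * (var j * carry q y u)"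

text \<open>The sum runs over the factorizations \<open>w = u i v\<close>, where \<open>u\<close> has length \<open>t\<close>. It is, up to a
  scalar, what evaluation of the \<open>X\<^sub>t\<close> makes of \<open>E\<^sub>n\<close> when \<open>i = 1\<close> and \<open>j = n\<close>; other \<open>j\<close> occur
  in the induction.\<close>

definition carry_sum :: "complex \<Rightarrow> int \<Rightarrow> int \<Rightarrow> int list \<Rightarrow> tensor" where
  "carry_sum q i j w = (\<Sum>t<length w.
     cst (if w ! t = i then inverse q ^ (count_list (drop (Suc t) w) i + t) else 0)
     * (carry q j (take t w) * mon (drop (Suc t) w)))"

lemma carry_sum_Nil [simp]: "carry_sum q i j [] = 0"
  by (simp add: carry_sum_def)

text \<open>A recursion in the first letter, of the same shape as the one for \<open>root_vec\<close>. The factor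
  \<open>q\<^sup>-\<^sup>t\<close> turns the coefficients \<open>q\<close>, \<open>q\<^sup>2\<close> and \<open>q\<^sup>2 - 1\<close> of \<open>carry\<close> into \<open>1\<close>, \<open>q\<close> and
  \<open>q - q\<^sup>-\<^sup>1\<close>.\<close>

lemma carry_sum_Cons:
  assumes "q \<noteq> 0"
  shows "carry_sum q i j (x # w) =
      cst (if x = i then inverse q ^ count_list w i else 0) * mon (j # w)
    + cst (if x = j then q else 1) * (var x * carry_sum q i j w)
    + cst (if x < j then q - inverse q else 0) * (var j * carry_sum q i x w)"
proof -
  have summand: "cst (if w ! t = i then inverse q ^ (count_list (drop (Suc t) w) i + Suc t) else 0)
      * (carry q j (x # take t w) * mon (drop (Suc t) w))
    = cst (if x = j then q else 1) * (var x * (cst (if w ! t = i then inverse q ^ (count_list (drop (Suc t) w) i + t) else 0)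
      * (carry q j (take t w) * mon (drop (Suc t) w))))
    + cst (if x < j then q - inverse q else 0) * (var j * (cst (if w ! t = i then inverse q ^ (count_list (drop (Suc t) w) i + t) else 0)
      * (carry q x (take t w) * mon (drop (Suc t) w))))" for t
    by (rule poly_mapping_eqI)
      (use assms in \<open>simp add: lookup_add distrib_right var_mult_cst mult.assoc power2_eq_square field_simps\<close>)
  have "carry_sum q i j (x # w) =
      cst (if x = i then inverse q ^ count_list w i else 0) * mon (j # w)
    + (\<Sum>t<length w. cst (if w ! t = i then inverse q ^ (count_list (drop (Suc t) w) i + Suc t) else 0)
      * (carry q j (x # take t w) * mon (drop (Suc t) w)))"
    unfolding carry_sum_def length_Cons sum.lessThan_Suc_shift by (simp add: mon_Cons[of j w] del: carry.simps(2) cong: if_cong)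
  also have "\<dots> = cst (if x = i then inverse q ^ count_list w i else 0) * mon (j # w)
    + cst (if x = j then q else 1) * (var x * carry_sum q i j w)
    + cst (if x < j then q - inverse q else 0) * (var j * carry_sum q i x w)"
    unfolding summand sum.distrib carry_sum_def sum_distrib_left by (simp add: add.assoc)
  finally show ?thesis .
qed

text \<open>Carrying the least letter \<open>i\<close> never leaves anything behind, so every summand is a multiple
  of \<open>w\<close> itself and the coefficients add up to the quantum integer of the number of letters \<open>i\<close>
  in \<open>w\<close>. Multiplying by \<open>q - q\<^sup>-\<^sup>1\<close> keeps the statement free of division.\<close>

lemma carry_sum_least:
  assumes "q \<noteq> 0" and "\<forall>x\<in>set w. i \<le> x"
  shows "cst (q - inverse q) * carry_sum q i i w
    = cst (q ^ count_list w i - inverse q ^ count_list w i) * mon w"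
  using assms(2)
proof (induction w)
  case Nil
  then show ?case by simp
next
  case (Cons x w)
  have IH: "cst (q - inverse q) * (var x * carry_sum q i i w)
    = cst (q ^ count_list w i - inverse q ^ count_list w i) * mon (x # w)"
    using Cons by (simp add: mon_Cons[of x w] flip: var_mult_cst)
  have IH': "(q - inverse q) * Poly_Mapping.lookup (var x * carry_sum q i i w) v
      = (q ^ count_list w i - inverse q ^ count_list w i) * Poly_Mapping.lookup (mon (x # w)) v" for v
    using arg_cong[OF IH, of "\<lambda>y. Poly_Mapping.lookup y v"] by simp
  show ?case
  proof (rule poly_mapping_eqI)
    fix v
    show "Poly_Mapping.lookup (cst (q - inverse q) * carry_sum q i i (x # w)) v
      = Poly_Mapping.lookup (cst (q ^ count_list (x # w) i - inverse q ^ count_list (x # w) i) * mon (x # w)) v"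
    proof (cases "x = i")
      case True
      have "(q - inverse q) * (inverse q ^ count_list w i * Poly_Mapping.lookup (mon (x # w)) v
          + q * Poly_Mapping.lookup (var x * carry_sum q i i w) v)
        = (q - inverse q) * inverse q ^ count_list w i * Poly_Mapping.lookup (mon (x # w)) v
          + q * ((q - inverse q) * Poly_Mapping.lookup (var x * carry_sum q i i w) v)"
        by (simp add: algebra_simps)
      then show ?thesis
        using True assms(1) unfolding IH' by (simp add: carry_sum_Cons lookup_add algebra_simps)
    next
      case False
      then show ?thesis using assms(1) Cons.prems IH' by (simp add: carry_sum_Cons lookup_add)
    qed
  qed
qed

text \<open>The heart of the proof: both sides satisfy the same recursion in the first letter \<open>x\<close>. This
  is immediate for \<open>x > i\<close>. For \<open>x = i\<close> the last term of \<open>carry_sum_Cons\<close> is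
  \<open>(q - q\<^sup>-\<^sup>1) \<omega>\<^sub>j carry_sum q i i w\<close>, and by \<open>carry_sum_least\<close> it equals
  \<open>(q\<^sup>m - q\<^sup>-\<^sup>m) \<omega>\<^sub>j w\<close> with \<open>m\<close> the number of letters \<open>i\<close> in \<open>w\<close>; with the first term
  \<open>q\<^sup>-\<^sup>m \<omega>\<^sub>j w\<close> this makes \<open>q\<^sup>m \<omega>\<^sub>j w\<close>.\<close>

lemma root_vec_eq_carry_sum:
  assumes "q \<noteq> 0" and "\<forall>x\<in>set w. i \<le> x" and "i < j"
  shows "cst (q ^ count_list w i) * root_vec q i j w = cst q * carry_sum q i j w"
  using assms(2,3)
proof (induction w arbitrary: j)
  case Nil
  then show ?case by simp
next
  case (Cons x w)
  let ?m = "count_list w i"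
  have IH: "q ^ ?m * Poly_Mapping.lookup (y * root_vec q i k w) v
      = q * Poly_Mapping.lookup (y * carry_sum q i k w) v" if "i < k" for y k v
  proof -
    have "cst (q ^ ?m) * root_vec q i k w = cst q * carry_sum q i k w"
      using Cons.IH[OF _ that] Cons.prems by simp
    then have "y * (cst (q ^ ?m) * root_vec q i k w) = y * (cst q * carry_sum q i k w)" by simp
    then have "cst (q ^ ?m) * (y * root_vec q i k w) = cst q * (y * carry_sum q i k w)"
      by (simp only: mult_cst_left[of y])
    from arg_cong[OF this, of "\<lambda>y. Poly_Mapping.lookup y v"] show ?thesis by simp
  qed
  have least: "(q - inverse q) * Poly_Mapping.lookup (var j * carry_sum q i i w) v
      = (q ^ ?m - inverse q ^ ?m) * Poly_Mapping.lookup (mon (j # w)) v" for v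
  proof -
    have "var j * (cst (q - inverse q) * carry_sum q i i w) = var j * (cst (q ^ ?m - inverse q ^ ?m) * mon w)"
      using carry_sum_least[OF assms(1), of w i] Cons.prems by simp
    then have "cst (q - inverse q) * (var j * carry_sum q i i w) = cst (q ^ ?m - inverse q ^ ?m) * mon (j # w)"
      by (simp only: mult_cst_left[of "var j"] mon_Cons[of j w])
    from arg_cong[OF this, of "\<lambda>y. Poly_Mapping.lookup y v"] show ?thesis by simp
  qed
  show ?case
  proof (rule poly_mapping_eqI)
    fix v :: "int word"
    let ?l = "\<lambda>y :: tensor. Poly_Mapping.lookup y v"
    show "?l (cst (q ^ count_list (x # w) i) * root_vec q i j (x # w)) = ?l (cst q * carry_sum q i j (x # w))"
    proof (cases "x = i")
      case True
      have "q ^ count_list (x # w) i * ?l (root_vec q i j (x # w))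
        = q * q ^ ?m * ?l (mon (j # w)) + q ^ ?m * ?l (var x * root_vec q i j w)"
        using True assms(1) by (simp add: lookup_add algebra_simps)
      also have "\<dots> = q * (inverse q ^ ?m * ?l (mon (j # w)) + ?l (var x * carry_sum q i j w)
          + (q - inverse q) * ?l (var j * carry_sum q i i w))"
        unfolding IH[OF Cons.prems(2)] least by (simp add: algebra_simps)
      also have "\<dots> = q * ?l (carry_sum q i j (x # w))"
        using True assms(1) Cons.prems(2) by (simp add: carry_sum_Cons lookup_add)
      finally show ?thesis by simp
    next
      case False
      then have "i < x" using Cons.prems(1) by simp
      have "q ^ count_list (x # w) i * ?l (root_vec q i j (x # w))
        = (if x = j then q else 1) * (q ^ ?m * ?l (var x * root_vec q i j w))
          + (if x < j then q - inverse q else 0) * (q ^ ?m * ?l (var j * root_vec q i x w))"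
        using False \<open>i < x\<close> by (simp add: lookup_add algebra_simps)
      also have "\<dots> = q * ?l (carry_sum q i j (x # w))"
        unfolding IH[OF Cons.prems(2)] IH[OF \<open>i < x\<close>]
        using False assms(1) by (simp add: carry_sum_Cons lookup_add algebra_simps)
      finally show ?thesis by simp
    qed
  qed
qed

text \<open>Right multiplication by \<open>T\<^sub>k\<close>. Since \<open>fold\<close> applies the operator of the head of a list first,
  \<open>fold (T_op q) ks\<close> is right multiplication by the product of the \<open>T\<^sub>k\<close> in the order of \<open>ks\<close>.\<close>

definition T_op :: "complex \<Rightarrow> nat \<Rightarrow> tensor \<Rightarrow> tensor" where
  "T_op q k = lin_ext (T_act q k)"

lemma linear_op_fold_T_op: "linear_op (fold (T_op q) ks)"
proof (induction ks)
  case (Cons k ks)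
  then show ?case by (simp add: linear_op_def T_op_def lin_ext_add lin_ext_scale)
qed (simp add: linear_op_def)

lemma T_op_at:
  "T_op q (Suc (length z)) (mon (z @ x # y # v)) =
     (if x = y then cst (q ^ 2) * mon (z @ x # y # v)
      else if x < y then cst q * mon (z @ y # x # v)
      else cst q * mon (z @ y # x # v) + cst (q ^ 2 - 1) * mon (z @ x # y # v))"
  by (simp add: T_op_def T_act_def swap_at_def nth_append list_update_append)

text \<open>The prefix \<open>z\<close> is there for the induction on \<open>u\<close>: the letters already passed, which shift the
  indices of the \<open>T\<^sub>k\<close> still to come.\<close>

lemma fold_T_op_ascending:
  "fold (T_op q) [Suc (length z)..<Suc (length z + length u)] (mon (z @ j # u @ v))
     = mon z * (carry q j u * mon v)"
proof (induction u arbitrary: z j)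
  case Nil
  then show ?case by (simp add: mon_append mon_Cons[of j v])
next
  case (Cons y u)
  let ?ks = "[Suc (length (z @ [j]))..<Suc (length (z @ [j]) + length u)]"
  have ks: "[Suc (length z)..<Suc (length z + length (y # u))] = Suc (length z) # ?ks"
    by (simp add: upt_rec[of "Suc (length z)"] del: upt_Suc)
  have IH: "fold (T_op q) [Suc (length (z @ [c]))..<Suc (length (z @ [c]) + length u)] (mon (z @ a # b # u @ v))
      = mon z * (var a * (carry q b u * mon v))" for a b c
    using Cons.IH[of "z @ [a]" b] by (simp add: mon_append mult.assoc)
  show ?case
    unfolding ks fold_simps append_Cons T_op_at
    by (simp add: linear_op_add[OF linear_op_fold_T_op] linear_op_scale[OF linear_op_fold_T_op] IH
        distrib_left distrib_right mult.assoc mult_cst_left[of "mon z"] del: upt_Suc length_append)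
qed

text \<open>A letter that is at least as large as everything to its left moves to the front without
  producing further terms, with a factor \<open>q\<close> for each smaller letter and \<open>q\<^sup>2\<close> for each equal
  one.\<close>

lemma fold_T_op_descending:
  assumes "\<forall>y\<in>set u. y \<le> j"
  shows "fold (T_op q) (rev [1..<Suc (length u)]) (mon (u @ j # v))
    = cst (q ^ (length u + count_list u j)) * mon (j # u @ v)"
  using assms
proof (induction u arbitrary: v rule: rev_induct)
  case Nil
  then show ?case by simp
next
  case (snoc y u)
  have ks: "rev [1..<Suc (length (u @ [y]))] = Suc (length u) # rev [1..<Suc (length u)]" by simp
  have "y \<le> j" using snoc.prems by simp
  then have "T_op q (Suc (length u)) (mon ((u @ [y]) @ j # v))
      = cst (if y = j then q ^ 2 else q) * mon (u @ j # y # v)"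
    by (simp add: T_op_at)
  then show ?case
    unfolding ks fold_simps
    using snoc by (simp add: linear_op_scale[OF linear_op_fold_T_op] power2_eq_square
        flip: cst_mult mult.assoc del: upt_Suc)
qed

text \<open>The action of \<open>T\<^bsub>t-1\<^esub>\<dots>T\<^sub>1T\<^sub>1\<dots>T\<^bsub>t-1\<^esub>\<close>, where \<open>t\<close> is the position of the letter \<open>j\<close>.\<close>

lemma fold_T_op_evaluated_X:
  assumes "\<forall>y\<in>set u. y \<le> j"
  shows "fold (T_op q) (rev [1..<Suc (length u)] @ [1..<Suc (length u)]) (mon (u @ j # v))
    = cst (q ^ (length u + count_list u j)) * (carry q j u * mon v)"
  using fold_T_op_ascending[of q "[]" u j v]
  by (simp add: fold_T_op_descending[OF assms, unfolded One_nat_def]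
      linear_op_scale[OF linear_op_fold_T_op] del: upt_Suc)

section \<open>The action of the generators on words\<close>

lemma op_tensor_Cons [simp]: "op_tensor f g (mon (x # w)) = f (var x) * g (mon w)"
  by (simp add: op_tensor_def)

lemma linear_op_gen_act:
  assumes "r \<ge> 1"
  shows "linear_op (gen_act n q r g)"
proof (cases r)
  case (Suc r')
  have "linear_op (gen_act1 n q g)" "linear_op (op_tensor f h)" for f h
    by (simp_all add: gen_act1_def op_tensor_def)
  then show ?thesis
    using Suc by (cases g) (auto simp: linear_op_def distrib_left)
qed (use assms in simp)

lemma kd_eq:
  assumes "x \<in> {1..int n}" "y \<in> {1..int n}"
  shows "kd n x y = (if x = y then 1 else 0)"
proof -
  have "x = y" if "x mod int n = y mod int n"
  proof -
    have "(x - 1) mod int n = (y - 1) mod int n" using that by (metis mod_diff_left_eq)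
    then show ?thesis using assms by simp
  qed
  then show ?thesis by (auto simp: kd_def)
qed

lemma gen_act1_var [simp]: "gen_act1 n q g (var x) = omega_act n q g x"
  by (simp add: gen_act1_def)

lemma gen_act_singleton: "gen_act n q (length [x]) g (var x) = omega_act n q g x"
  by simp

lemma gen_act_Cons:
  assumes "w \<noteq> []"
  shows "gen_act n q (length (x # w)) g (mon (x # w)) = (\<Sum>(u, v)\<leftarrow>coprod n g.
    word_op (gen_act1 n q) u (var x) * word_op (gen_act n q (length w)) v (mon w))"
  using assms by simp

lemma gen_act1_cst_mult: "gen_act1 n q g (cst c * y) = cst c * gen_act1 n q g y"
  by (simp add: gen_act1_def lin_ext_scale)

lemma gen_act_K:
  assumes "i \<in> {1..int n}" "set w \<subseteq> {1..int n}" "w \<noteq> []"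
  shows "gen_act n q (length w) (GK i) (mon w) = cst (q ^ count_list w i) * mon w"
    and "gen_act n q (length w) (GKi i) (mon w) = cst (inverse q ^ count_list w i) * mon w"
proof -
  have "gen_act n q (length w) (GK i) (mon w) = cst (q ^ count_list w i) * mon w
    \<and> gen_act n q (length w) (GKi i) (mon w) = cst (inverse q ^ count_list w i) * mon w"
    using assms(2,3)
  proof (induction w)
    case (Cons x w)
    then have kd: "kd n i x = (if x = i then 1 else 0)" using assms(1) kd_eq by auto
    show ?case
    proof (cases "w = []")
      case True
      then show ?thesis using gen_act_singleton[of n q x] by (simp add: kd)
    next
      case False
      then have "gen_act n q (length w) (GK i) (mon w) = cst (q ^ count_list w i) * mon w"
        "gen_act n q (length w) (GKi i) (mon w) = cst (inverse q ^ count_list w i) * mon w"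
        using Cons by simp_all
      then show ?thesis unfolding gen_act_Cons[OF False]
        by (simp add: kd word_op_def mon_Cons[of x w] mult_cst_left[of "var x"] cst_mult mult.assoc)
    qed
  qed simp
  then show "gen_act n q (length w) (GK i) (mon w) = cst (q ^ count_list w i) * mon w"
    and "gen_act n q (length w) (GKi i) (mon w) = cst (inverse q ^ count_list w i) * mon w" by simp_all
qed

text \<open>The default value of \<open>gen_act\<close> on zero tensor factors agrees with \<open>root_vec\<close> on the empty word,
  so the induction can start there.\<close>

lemma gen_act_F:
  assumes "1 \<le> i" "i < int n" "set w \<subseteq> {1..int n}"
  shows "gen_act n q (length w) (GF i) (mon w) = root_vec q i (i + 1) w"
  using assms(3)
proof (induction w)
  case (Cons x w)
  have kd: "kd n i x = (if x = i then 1 else 0)" "kd n (i + 1) x = (if x = i + 1 then 1 else 0)"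
    using kd_eq[of i n x] kd_eq[of "i + 1" n x] assms(1,2) Cons.prems by auto
  have rep: "rep n (i + 1) = i + 1" using assms(1,2) by (simp add: rep_def)
  show ?case
  proof (cases "w = []")
    case True
    then show ?thesis using gen_act_singleton[of n q x] by (simp add: kd)
  next
    case False
    then show ?thesis using Cons unfolding gen_act_Cons[OF False]
      by (auto simp add: kd rep word_op_def gen_act1_cst_mult mult.assoc mon_Cons[of "i + 1" w])
  qed
qed simp

text \<open>On letters in \<open>1, \<dots>, n\<close> the generator \<open>E\<^sub>n\<close> turns a letter \<open>1\<close> into \<open>0\<close>, and the coproduct
  puts \<open>K\<^sub>nK\<^sub>1\<^sup>-\<^sup>1\<close> on the letters to its right.\<close>

lemma gen_act_E_last:
  assumes "n \<ge> 2" "set w \<subseteq> {1..int n}"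
  shows "gen_act n q (length w) (GE (int n)) (mon w) = (\<Sum>t<length w.
     cst (if w ! t = 1 then q ^ count_list (drop (Suc t) w) (int n)
       * inverse q ^ count_list (drop (Suc t) w) 1 else 0)
     * mon (take t w @ 0 # drop (Suc t) w))"
  using assms(2)
proof (induction w)
  case (Cons x w)
  have "kd n (int n + 1) x = kd n 1 x" by (simp add: kd_def)
  then have kd: "kd n (int n + 1) x = (if x = 1 then 1 else 0)"
    using kd_eq[of 1 n x] assms(1) Cons.prems by auto
  have rep: "rep n (int n + 1) = 1" by (simp add: rep_def)
  show ?case
  proof (cases "w = []")
    case True
    then show ?thesis using gen_act_singleton[of n q x] by (simp add: kd)
  next
    case False
    have K: "gen_act n q (length w) (GK (int n)) (cst c * mon w) = cst c * (cst (q ^ count_list w (int n)) * mon w)"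
      "gen_act n q (length w) (GKi 1) (mon w) = cst (inverse q ^ count_list w 1) * mon w" for c
      using gen_act_K[of _ n w q] linear_op_scale[OF linear_op_gen_act] False Cons.prems assms(1)
      by (simp_all add: Suc_le_eq)
    have "gen_act n q (length (x # w)) (GE (int n)) (mon (x # w))
      = cst (if x = 1 then q ^ count_list w (int n) * inverse q ^ count_list w 1 else 0) * mon (0 # w)
        + var x * gen_act n q (length w) (GE (int n)) (mon w)"
      unfolding gen_act_Cons[OF False]
      by (simp add: kd rep word_op_def K mon_Cons[of 0 w] mult_cst_left[of "var 0"]
          cst_mult mult_cst_left[of "cst (inverse q ^ count_list w 1)"] mult.assoc)
    also have "\<dots> = cst (if x = 1 then q ^ count_list w (int n) * inverse q ^ count_list w 1 else 0) * mon (0 # w)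
      + (\<Sum>t<length w. cst (if w ! t = 1 then q ^ count_list (drop (Suc t) w) (int n)
       * inverse q ^ count_list (drop (Suc t) w) 1 else 0)
     * mon (x # take t w @ 0 # drop (Suc t) w))"
      using Cons by (simp add: sum_distrib_left mult_cst_left[of "var x"] flip: mon_Cons)
    finally show ?thesis
      unfolding length_Cons sum.lessThan_Suc_shift by (simp cong: if_cong)
  qed
qed simp

section \<open>Presented algebras\<close>

lemma free_alg_simps [simp]:
  "carrier (free_alg G) = span_words (lists G)"
  "x \<otimes>\<^bsub>free_alg G\<^esub> y = x * y" "x \<oplus>\<^bsub>free_alg G\<^esub> y = x + y"
  "\<one>\<^bsub>free_alg G\<^esub> = 1" "\<zero>\<^bsub>free_alg G\<^esub> = 0"
  by (simp_all add: free_alg_def span_words_def lists_eq_set)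

lemma span_lists_one: "1 \<in> span_words (lists G)"
  by (simp flip: mon_Nil)

lemma span_lists_cst: "cst c \<in> span_words (lists G)"
  using span_words_cst_mult[OF span_lists_one, of c G] by simp

lemma span_lists_var: "g \<in> G \<Longrightarrow> var g \<in> span_words (lists G)"
  by simp

lemma span_lists_mult:
  "x \<in> span_words (lists G) \<Longrightarrow> y \<in> span_words (lists G) \<Longrightarrow> x * y \<in> span_words (lists G)"
  by (rule span_words_mult[of _ "lists G" _ "lists G"]) auto

lemma span_lists_power: "x \<in> span_words (lists G) \<Longrightarrow> x ^ k \<in> span_words (lists G)"
  by (induction k) (simp_all add: span_lists_one span_lists_mult)

lemmas span_lists_intros = span_lists_one span_lists_cst span_lists_var span_lists_mult
  span_lists_power span_words_add span_words_diff span_words_sum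

lemma ring_free_alg: "ring (free_alg G)"
proof (rule ringI)
  show "abelian_group (free_alg G)"
  proof (rule abelian_groupI)
    fix x assume "x \<in> carrier (free_alg G)"
    then show "\<exists>y\<in>carrier (free_alg G). y \<oplus>\<^bsub>free_alg G\<^esub> x = \<zero>\<^bsub>free_alg G\<^esub>"
      by (intro bexI[of _ "- x"]) (simp_all add: span_words_uminus)
  qed (simp_all add: span_words_add algebra_simps)
  show "Group.monoid (free_alg G)"
    by (rule monoidI) (simp_all add: span_lists_one span_lists_mult mult.assoc)
qed (simp_all add: algebra_simps)

text \<open>\<open>Idl\<close> is the intersection of all ideals containing the relations. It is an ideal only if there
  is such an ideal at all, that is, if the relations use no letters outside \<open>G\<close>.\<close>

locale presentation =
  fixes G :: "'a set" and R :: "'a free set"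
  assumes rels: "R \<subseteq> span_words (lists G)"
begin

lemma ideal_rels: "ideal (Idl\<^bsub>free_alg G\<^esub> R) (free_alg G)"
  using ring.genideal_ideal[OF ring_free_alg, of R G] rels by simp

lemma presented_simps:
  "carrier (presented G R) = carrier (free_alg G Quot Idl\<^bsub>free_alg G\<^esub> R)"
  "x \<otimes>\<^bsub>presented G R\<^esub> y = x \<otimes>\<^bsub>free_alg G Quot Idl\<^bsub>free_alg G\<^esub> R\<^esub> y"
  "x \<oplus>\<^bsub>presented G R\<^esub> y = x \<oplus>\<^bsub>free_alg G Quot Idl\<^bsub>free_alg G\<^esub> R\<^esub> y"
  "\<one>\<^bsub>presented G R\<^esub> = \<one>\<^bsub>free_alg G Quot Idl\<^bsub>free_alg G\<^esub> R\<^esub>"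
  "\<zero>\<^bsub>presented G R\<^esub> = \<zero>\<^bsub>free_alg G Quot Idl\<^bsub>free_alg G\<^esub> R\<^esub>"
  "c \<odot>\<^bsub>presented G R\<^esub> x = (Idl\<^bsub>free_alg G\<^esub> R +>\<^bsub>free_alg G\<^esub> cst c) \<otimes>\<^bsub>free_alg G Quot Idl\<^bsub>free_alg G\<^esub> R\<^esub> x"
  by (simp_all add: presented_def Let_def)

lemma ring_presented: "ring (presented G R)"
proof -
  interpret Q: ring "free_alg G Quot Idl\<^bsub>free_alg G\<^esub> R"
    by (rule ideal.quotient_is_ring[OF ideal_rels])
  show ?thesis
  proof (rule ringI)
    show "abelian_group (presented G R)"
    proof (rule abelian_groupI)
      fix x assume "x \<in> carrier (presented G R)"
      then show "\<exists>y\<in>carrier (presented G R). y \<oplus>\<^bsub>presented G R\<^esub> x = \<zero>\<^bsub>presented G R\<^esub>"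
        by (intro bexI[of _ "\<ominus>\<^bsub>free_alg G Quot Idl\<^bsub>free_alg G\<^esub> R\<^esub> x"])
          (simp_all add: presented_simps Q.l_neg)
    qed (simp_all add: presented_simps Q.a_assoc Q.a_comm Q.a_lcomm)
    show "Group.monoid (presented G R)"
      by (rule monoidI) (simp_all add: presented_simps Q.m_assoc)
  qed (simp_all add: presented_simps Q.l_distr Q.r_distr)
qed

lemma coset_hom: "(+>\<^bsub>free_alg G\<^esub>) (Idl\<^bsub>free_alg G\<^esub> R) \<in> ring_hom (free_alg G) (presented G R)"
  using ideal.rcos_ring_hom[OF ideal_rels] by (simp add: ring_hom_def presented_simps)

lemma pgen_closed: "g \<in> G \<Longrightarrow> pgen G R g \<in> carrier (presented G R)"
  using ring_hom_closed[OF coset_hom, of "var g"] by (simp add: pgen_def)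

lemma smult_closed: "x \<in> carrier (presented G R) \<Longrightarrow> c \<odot>\<^bsub>presented G R\<^esub> x \<in> carrier (presented G R)"
  using ring_hom_closed[OF coset_hom, of "cst c"] span_lists_cst[of c G]
    monoid.m_closed[OF ring.is_monoid[OF ring_presented]]
  by (simp add: presented_simps)

lemma pgen_inverse:
  assumes "g \<in> G" "h \<in> G" and rel: "var g * var h - 1 \<in> R"
  shows "pgen G R g \<otimes>\<^bsub>presented G R\<^esub> pgen G R h = \<one>\<^bsub>presented G R\<^esub>"
proof -
  interpret I: ideal "Idl\<^bsub>free_alg G\<^esub> R" "free_alg G" by (rule ideal_rels)
  have "var g * var h - 1 \<in> Idl\<^bsub>free_alg G\<^esub> R"
    using ring.genideal_self[OF ring_free_alg, of R G] rels rel by auto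
  then have "var g * var h \<in> Idl\<^bsub>free_alg G\<^esub> R +>\<^bsub>free_alg G\<^esub> 1"
    unfolding a_r_coset_def' by (auto intro!: bexI)
  then have "Idl\<^bsub>free_alg G\<^esub> R +>\<^bsub>free_alg G\<^esub> var g * var h = Idl\<^bsub>free_alg G\<^esub> R +>\<^bsub>free_alg G\<^esub> 1"
    by (intro I.a_repr_independence[symmetric] I.a_subgroup) (simp_all add: span_lists_one)
  then show ?thesis
    using ring_hom_mult[OF coset_hom, of "var g" "var h"] ring_hom_one[OF coset_hom] assms(1,2)
    by (simp add: pgen_def)
qed

lemma alg_prod_closed:
  "set xs \<subseteq> carrier (presented G R) \<Longrightarrow> alg_prod (presented G R) xs \<in> carrier (presented G R)"
proof (induction xs)
  case Nil
  then show ?case using monoid.one_closed[OF ring.is_monoid[OF ring_presented]] by (simp add: alg_prod_def)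
next
  case (Cons x xs)
  then show ?case using monoid.m_closed[OF ring.is_monoid[OF ring_presented], of x "alg_prod (presented G R) xs"]
    by (simp add: alg_prod_def)
qed

end

lemma D_presentation:
  assumes "n \<ge> 1"
  shows "presentation (D_gens n) (D_rels n q)"
proof
  have rep: "rep n (i + 1) \<in> {1..int n}" for i
    using assms by (simp add: rep_def add1_zle_eq)
  have gens: "GE i \<in> D_gens n" "GF i \<in> D_gens n" "GK i \<in> D_gens n" "GKi i \<in> D_gens n"
    if "i \<in> {1..int n}" for i
    using that by (auto simp: D_gens_def)
  have gens': "GZp s \<in> D_gens n" "GZm s \<in> D_gens n" if "s \<ge> 1" for s
    using that by (auto simp: D_gens_def)
  have serre: "serre n q g i j \<in> span_words (lists (D_gens n))" if "g i \<in> D_gens n" "g j \<in> D_gens n" for g i j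
    unfolding serre_def Let_def by (intro span_lists_intros that)
  show "D_rels n q \<subseteq> span_words (lists (D_gens n))"
    unfolding D_rels_def Let_def
    by (intro Un_least subsetI; clarify;
        (intro span_lists_intros gens gens' rep serre)?; (assumption | auto intro: gens'))
qed

lemma H_presentation: "presentation (H_gens r) (H_rels r q)"
proof
  have gens: "i \<in> {1..<r} \<Longrightarrow> HT i \<in> H_gens r" "i \<in> {1..r} \<Longrightarrow> HX i \<in> H_gens r"
    "i \<in> {1..r} \<Longrightarrow> HXi i \<in> H_gens r" for i
    by (auto simp: H_gens_def)
  show "H_rels r q \<subseteq> span_words (lists (H_gens r))"
    unfolding H_rels_def
    by (intro Un_least subsetI; clarify;
        intro span_lists_intros gens; simp)
qed

section \<open>The operator of the evaluated generator\<close>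

definition fin_words :: "nat \<Rightarrow> nat \<Rightarrow> int list set" where
  "fin_words n r = {w. length w = r \<and> set w \<subseteq> {1..int n}}"

lemma Omega_eq: "Omega r = span_words {w. length w = r}"
  by (simp add: Omega_def span_words_def)

lemma Omega_fin_eq: "Omega_fin n r = span_words (fin_words n r)"
  by (simp add: Omega_fin_def span_words_def fin_words_def)

lemma Omega_fin_subset: "Omega_fin n r \<subseteq> Omega r"
  by (auto simp: Omega_def Omega_fin_def)

lemma Omega_add: "x \<in> Omega r \<Longrightarrow> y \<in> Omega r \<Longrightarrow> x + y \<in> Omega r"
  and Omega_cst_mult: "x \<in> Omega r \<Longrightarrow> cst c * x \<in> Omega r"
  and Omega_zero: "0 \<in> Omega r"
  by (simp_all add: Omega_eq span_words_add span_words_cst_mult)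

lemma linear_maps_D:
  assumes "f \<in> linear_maps V W"
  shows "x \<in> V \<Longrightarrow> y \<in> V \<Longrightarrow> f (x + y) = f x + f y"
    and "x \<in> V \<Longrightarrow> f (cst c * x) = cst c * f x"
    and "x \<in> V \<Longrightarrow> f x \<in> W"
  using assms by (auto simp: linear_maps_def)

lemma linear_eq_on_Omega_fin:
  assumes "x \<in> Omega_fin n r"
    and "\<And>w. w \<in> fin_words n r \<Longrightarrow> f (mon w) = g (mon w)"
    and f: "\<And>x y. x \<in> Omega_fin n r \<Longrightarrow> y \<in> Omega_fin n r \<Longrightarrow> f (x + y) = f x + f y"
      "\<And>c x. x \<in> Omega_fin n r \<Longrightarrow> f (cst c * x) = cst c * f x"
    and g: "\<And>x y. x \<in> Omega_fin n r \<Longrightarrow> y \<in> Omega_fin n r \<Longrightarrow> g (x + y) = g x + g y"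
      "\<And>c x. x \<in> Omega_fin n r \<Longrightarrow> g (cst c * x) = cst c * g x"
  shows "f x = g x"
  using assms(1)[unfolded Omega_fin_eq]
proof (induction rule: span_words_induct)
  case zero
  have "0 \<in> Omega_fin n r" by (simp add: Omega_fin_eq)
  then show ?case using f(2)[of 0 0] g(2)[of 0 0] by simp
qed (simp_all add: assms(2) f g Omega_fin_eq)

lemma alg_hom_End_mult:
  assumes "\<zeta> \<in> alg_hom A (End_alg V)" "x \<in> carrier A" "y \<in> carrier A" "v \<in> V"
  shows "\<zeta> (x \<otimes>\<^bsub>A\<^esub> y) v = \<zeta> x (\<zeta> y v)"
  using assms by (simp add: alg_hom_def ring_hom_def End_alg_def compose_def)

lemma alg_hom_End_smult:
  assumes "\<zeta> \<in> alg_hom A (End_alg V)" "x \<in> carrier A" "v \<in> V"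
  shows "\<zeta> (c \<odot>\<^bsub>A\<^esub> x) v = cst c * \<zeta> x v"
  using assms by (simp add: alg_hom_def End_alg_def)

lemma alg_hom_End_linear:
  assumes "\<zeta> \<in> alg_hom A (End_alg V)" "x \<in> carrier A"
  shows "\<zeta> x \<in> linear_maps V V"
  using assms by (auto simp: alg_hom_def ring_hom_def End_alg_def)

text \<open>Subtraction in \<open>A\<close> is defined through additive inverses, of which a homomorphism need not know
  anything when its target is not known to be a ring. So the bracket is characterized by adding
  the subtracted term back.\<close>

lemma alg_hom_End_qbracket:
  assumes \<zeta>: "\<zeta> \<in> alg_hom A (End_alg V)" and "ring A" and x: "x \<in> carrier A" and y: "y \<in> carrier A"
    and smult: "\<And>z. z \<in> carrier A \<Longrightarrow> b \<odot>\<^bsub>A\<^esub> z \<in> carrier A" and v: "v \<in> V"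
  shows "\<zeta> (qbracket A b x y) v = \<zeta> x (\<zeta> y v) - cst b * \<zeta> y (\<zeta> x v)"
proof -
  interpret A: ring A by fact
  let ?z = "qbracket A b x y" and ?yx = "b \<odot>\<^bsub>A\<^esub> (y \<otimes>\<^bsub>A\<^esub> x)"
  have yx: "?yx \<in> carrier A" using x y smult by simp
  then have z: "?z \<in> carrier A" using x y by (simp add: qbracket_def)
  have "?z \<oplus>\<^bsub>A\<^esub> ?yx = x \<otimes>\<^bsub>A\<^esub> y"
    using x y yx by (simp add: qbracket_def a_minus_def A.a_assoc A.l_neg)
  moreover have "\<zeta> (?z \<oplus>\<^bsub>A\<^esub> ?yx) v = \<zeta> ?z v + \<zeta> ?yx v"
    using \<zeta> z yx v by (simp add: alg_hom_def ring_hom_def End_alg_def)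
  ultimately have "\<zeta> x (\<zeta> y v) = \<zeta> ?z v + cst b * \<zeta> y (\<zeta> x v)"
    using alg_hom_End_mult[OF \<zeta> x y v] alg_hom_End_mult[OF \<zeta> y x v]
      alg_hom_End_smult[OF \<zeta> _ v, of "y \<otimes>\<^bsub>A\<^esub> x"] x y by simp
  then show ?thesis by simp
qed

lemma root_vec_in_span:
  assumes "w \<in> fin_words n r" "j \<in> {1..int n}"
  shows "root_vec q i j w \<in> span_words (fin_words n r)"
  using assms
proof (induction w arbitrary: r j)
  case (Cons x w)
  have "var k * y \<in> span_words (fin_words n r)"
    if "k \<in> {1..int n}" "y \<in> span_words (fin_words n (length w))" for k y
    by (rule span_words_mult[of _ "{[k]}" _ "fin_words n (length w)"])
      (use that Cons.prems in \<open>auto simp: fin_words_def\<close>)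
  moreover have "w \<in> fin_words n (length w)" "x \<in> {1..int n}"
    using Cons.prems by (auto simp: fin_words_def)
  moreover have "mon (j # w) \<in> span_words (fin_words n r)"
    using Cons.prems by (auto simp: fin_words_def)
  ultimately show ?case
    using Cons.IH[of "length w"] Cons.prems(2)
    unfolding root_vec.simps by (intro span_words_add span_words_cst_mult) blast+
qed simp

lemma root_op_in_Omega_fin:
  "v \<in> Omega_fin n r \<Longrightarrow> j \<in> {1..int n} \<Longrightarrow> root_op q i j v \<in> Omega_fin n r"
  unfolding Omega_fin_eq by (rule lin_ext_in_span_words[OF root_vec_in_span])

lemma is_zeta_affine_gen:
  assumes "is_zeta_affine n q r \<zeta>" "g \<in> D_gens n" "x \<in> Omega r"
  shows "\<zeta> (dg n q g) x = gen_act n q r g x"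
  using assms by (simp add: is_zeta_affine_def)

lemma D_gens_iff [simp]:
  "GE i \<in> D_gens n \<longleftrightarrow> i \<in> {1..int n}" "GF i \<in> D_gens n \<longleftrightarrow> i \<in> {1..int n}"
  "GK i \<in> D_gens n \<longleftrightarrow> i \<in> {1..int n}" "GKi i \<in> D_gens n \<longleftrightarrow> i \<in> {1..int n}"
  by (auto simp: D_gens_def)

lemma zeta_F:
  assumes \<zeta>: "is_zeta_affine n q r \<zeta>" and "r \<ge> 1" "1 \<le> i" "i < int n" and v: "v \<in> Omega_fin n r"
  shows "\<zeta> (dg n q (GF i)) v = root_op q i (i + 1) v"
proof -
  have "gen_act n q r (GF i) v = root_op q i (i + 1) v"
  proof (rule linear_eq_on_Omega_fin[OF v])
    show "gen_act n q r (GF i) (mon w) = root_op q i (i + 1) (mon w)" if "w \<in> fin_words n r" for w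
      using gen_act_F[of i n w q] that assms by (auto simp: fin_words_def)
  qed (use linear_op_gen_act[OF \<open>r \<ge> 1\<close>] in \<open>simp_all add: linear_op_def lin_ext_add lin_ext_scale\<close>)
  then show ?thesis
    using is_zeta_affine_gen[OF \<zeta>, of "GF i" v] assms Omega_fin_subset by auto
qed

text \<open>Both factors of each bracket preserve \<open>\<Omega>\<^sub>n\<^sup>\<otimes>\<^sup>r\<close>, so the induction can stay on that subspace,
  where \<open>F\<^sub>i\<close> never meets a letter congruent to \<open>i\<close> or \<open>i + 1\<close> other than these two.\<close>

lemma zeta_nested_F:
  assumes \<zeta>: "is_zeta_affine n q r \<zeta>" and "r \<ge> 1" "q \<noteq> 0" "k + 2 \<le> n"
  shows "nested_F n q k \<in> carrier (D_alg n q)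
    \<and> (\<forall>v\<in>Omega_fin n r. \<zeta> (nested_F n q k) v = root_op q 1 (int k + 2) v)"
  using \<open>k + 2 \<le> n\<close>
proof (induction k)
  case 0
  interpret presentation "D_gens n" "D_rels n q" using 0 by (intro D_presentation) simp
  show ?case using 0 zeta_F[OF assms(1,2), of 1] by (simp add: D_alg_def pgen_closed)
next
  case (Suc k)
  interpret presentation "D_gens n" "D_rels n q" using Suc by (intro D_presentation) simp
  interpret D: ring "D_alg n q" unfolding D_alg_def by (rule ring_presented)
  let ?F = "dg n q (GF (int k + 2))"
  have F: "?F \<in> carrier (D_alg n q)" using Suc.prems by (simp add: D_alg_def pgen_closed)
  have N: "nested_F n q k \<in> carrier (D_alg n q)" using Suc by simp
  have smult: "c \<odot>\<^bsub>D_alg n q\<^esub> z \<in> carrier (D_alg n q)" if "z \<in> carrier (D_alg n q)" for c z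
    using that smult_closed by (simp add: D_alg_def)
  have hom: "\<zeta> \<in> alg_hom (D_alg n q) (End_alg (Omega r))"
    using \<zeta> by (simp add: is_zeta_affine_def)
  show ?case
  proof (intro conjI ballI)
    show "nested_F n q (Suc k) \<in> carrier (D_alg n q)"
      using F N by (simp add: qbracket_def smult)
    fix v assume v: "v \<in> Omega_fin n r"
    have "\<zeta> (nested_F n q (Suc k)) v
      = \<zeta> ?F (\<zeta> (nested_F n q k) v) - cst (inverse q) * \<zeta> (nested_F n q k) (\<zeta> ?F v)"
      using alg_hom_End_qbracket[OF hom D.ring_axioms F N smult, of v "inverse q"] v Omega_fin_subset by auto
    also have "\<dots> = root_op q (int k + 2) (int k + 2 + 1) (root_op q 1 (int k + 2) v)
      - cst (inverse q) * root_op q 1 (int k + 2) (root_op q (int k + 2) (int k + 2 + 1) v)"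
      using Suc v zeta_F[OF assms(1,2), of "int k + 2"] root_op_in_Omega_fin[OF v] by simp
    also have "\<dots> = root_op q 1 (int k + 2 + 1) v"
      by (rule root_op_step[symmetric]) (use \<open>q \<noteq> 0\<close> in simp_all)
    finally show "\<zeta> (nested_F n q (Suc k)) v = root_op q 1 (int (Suc k) + 2) v"
      by (simp add: algebra_simps)
  qed
qed

text \<open>\<open>K\<^sub>1\<close> contributes exactly the power of \<open>q\<close> that \<open>root_vec_eq_carry_sum\<close> asks for, and the
  remaining \<open>q\<^sup>-\<^sup>1\<close> of the evaluation map cancels the \<open>q\<close> on its right-hand side.\<close>

lemma zeta_Ev_E_last:
  assumes \<zeta>: "is_zeta_affine n q r \<zeta>" and Ev: "is_Ev n q a Ev"
    and "n \<ge> 2" "r \<ge> 1" "q \<noteq> 0" and w: "w \<in> fin_words n r"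
  shows "\<zeta> (Ev (dg n q (GE (int n)))) (mon w) = cst (a * q ^ count_list w (int n)) * carry_sum q 1 (int n) w"
proof -
  interpret presentation "D_gens n" "D_rels n q" using assms by (intro D_presentation) simp
  interpret D: ring "D_alg n q" unfolding D_alg_def by (rule ring_presented)
  have hom: "\<zeta> \<in> alg_hom (D_alg n q) (End_alg (Omega r))"
    using \<zeta> by (simp add: is_zeta_affine_def)
  let ?N = "nested_F n q (n - 2)"
  have N: "?N \<in> carrier (D_alg n q)" "\<And>v. v \<in> Omega_fin n r \<Longrightarrow> \<zeta> ?N v = root_op q 1 (int n) v"
    using zeta_nested_F[OF assms(1,4,5), of "n - 2"] \<open>n \<ge> 2\<close> by simp_all
  have K: "dg n q (GK i) \<in> carrier (D_alg n q)" if "i \<in> {1..int n}" for i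
    using that by (simp add: D_alg_def pgen_closed)
  have fin: "mon w \<in> Omega_fin n r" using w by (simp add: Omega_fin_eq)
  have "w \<noteq> []" using w \<open>r \<ge> 1\<close> by (auto simp: fin_words_def)
  from fin have inf: "mon w \<in> Omega r" using Omega_fin_subset by blast
  have actK: "\<zeta> (dg n q (GK i)) (cst c * mon w) = cst (c * q ^ count_list w i) * mon w" if "i \<in> {1..int n}" for i c
  proof -
    have "\<zeta> (dg n q (GK i)) (mon w) = cst (q ^ count_list w i) * mon w"
      using that w \<open>r \<ge> 1\<close> \<open>w \<noteq> []\<close> gen_act_K(1)[of i n w q] is_zeta_affine_gen[OF \<zeta> _ inf, of "GK i"]
      by (auto simp: fin_words_def)
    then show ?thesis
      using linear_maps_D(2)[OF alg_hom_End_linear[OF hom K[OF that]] inf]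
      by (simp add: cst_mult mult.assoc)
  qed
  have prod: "alg_prod (D_alg n q) [?N, dg n q (GK 1), dg n q (GK (int n))]
      = ?N \<otimes>\<^bsub>D_alg n q\<^esub> (dg n q (GK 1) \<otimes>\<^bsub>D_alg n q\<^esub> dg n q (GK (int n)))"
    using N K \<open>n \<ge> 2\<close> by (simp add: alg_prod_def)
  have "\<zeta> (Ev (dg n q (GE (int n)))) (mon w)
    = cst (a * inverse q) * \<zeta> ?N (\<zeta> (dg n q (GK 1)) (\<zeta> (dg n q (GK (int n))) (mon w)))"
    using Ev N K \<open>n \<ge> 2\<close> inf
    by (simp add: is_Ev_def Let_def prod alg_hom_End_smult[OF hom] alg_hom_End_mult[OF hom])
  also have "\<dots> = cst (a * inverse q) * \<zeta> ?N (cst (q ^ count_list w (int n) * q ^ count_list w 1) * mon w)"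
    using actK[of 1] actK[of "int n" 1] \<open>n \<ge> 2\<close> by simp
  also have "\<dots> = cst (a * inverse q) * (cst (q ^ count_list w (int n) * q ^ count_list w 1) * root_vec q 1 (int n) w)"
    using N(2)[of "cst (q ^ count_list w (int n) * q ^ count_list w 1) * mon w"] fin
    by (simp add: lin_ext_scale Omega_fin_eq span_words_cst_mult)
  also have "\<dots> = cst (a * inverse q * q ^ count_list w (int n)) * (cst (q ^ count_list w 1) * root_vec q 1 (int n) w)"
    by (simp add: cst_mult mult.assoc)
  also have "\<dots> = cst (a * inverse q * q ^ count_list w (int n)) * (cst q * carry_sum q 1 (int n) w)"
  proof -
    have "\<forall>x\<in>set w. 1 \<le> x" using w by (auto simp: fin_words_def)
    then show ?thesis using root_vec_eq_carry_sum[of q w 1 "int n"] \<open>q \<noteq> 0\<close> \<open>n \<ge> 2\<close> by simp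
  qed
  also have "\<dots> = cst (a * q ^ count_list w (int n)) * carry_sum q 1 (int n) w"
    using \<open>q \<noteq> 0\<close> by (simp add: mult.assoc[symmetric] flip: cst_mult) (simp add: field_simps)
  finally show ?thesis .
qed

section \<open>The evaluated operator of the generator\<close>

lemma T_act_in_span:
  assumes "w \<in> fin_words n r" "k \<in> {1..<r}"
  shows "T_act q k w \<in> span_words (fin_words n r)"
proof -
  have "set (swap_at k w) = set w"
    unfolding swap_at_def by (rule set_swap) (use assms in \<open>auto simp: fin_words_def\<close>)
  moreover have "length (swap_at k w) = length w" by (simp add: swap_at_def)
  ultimately have "swap_at k w \<in> fin_words n r" using assms(1) by (simp add: fin_words_def)
  then show ?thesis
    using assms(1) by (simp add: T_act_def span_words_add span_words_cst_mult)
qed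

lemma T_op_in_Omega_fin:
  "v \<in> Omega_fin n r \<Longrightarrow> k \<in> {1..<r} \<Longrightarrow> T_op q k v \<in> Omega_fin n r"
  unfolding Omega_fin_eq T_op_def by (rule lin_ext_in_span_words[OF T_act_in_span])

lemma H_gens_iff [simp]:
  "HT i \<in> H_gens r \<longleftrightarrow> i \<in> {1..<r}" "HX i \<in> H_gens r \<longleftrightarrow> i \<in> {1..r}" "HXi i \<in> H_gens r \<longleftrightarrow> i \<in> {1..r}"
  by (auto simp: H_gens_def)

lemma hg_closed: "g \<in> H_gens r \<Longrightarrow> hg r q g \<in> carrier (H_affine r q)"
  using presentation.pgen_closed[OF H_presentation] by (simp add: H_affine_def)

lemma T_prod_closed:
  assumes "set ks \<subseteq> {1..<r}"
  shows "alg_prod (H_affine r q) (map (\<lambda>k. hg r q (HT k)) ks) \<in> carrier (H_affine r q)"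
proof -
  have "set (map (\<lambda>k. hg r q (HT k)) ks) \<subseteq> carrier (H_affine r q)"
    using assms by (auto intro!: hg_closed)
  then show ?thesis
    unfolding H_affine_def by (rule presentation.alg_prod_closed[OF H_presentation])
qed

lemma hecke_action_linear:
  assumes "is_hecke_action n q r act" "h \<in> carrier (H_affine r q)"
  shows "x \<in> Omega r \<Longrightarrow> y \<in> Omega r \<Longrightarrow> act (x + y) h = act x h + act y h"
    and "x \<in> Omega r \<Longrightarrow> act (cst c * x) h = cst c * act x h"
proof -
  have lin: "(\<lambda>x\<in>Omega r. act x h) \<in> linear_maps (Omega r) (Omega r)"
    using assms by (simp add: is_hecke_action_def is_right_module_def)
  show "x \<in> Omega r \<Longrightarrow> y \<in> Omega r \<Longrightarrow> act (x + y) h = act x h + act y h"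
    using linear_maps_D(1)[OF lin, of x y] by (simp add: Omega_add)
  show "x \<in> Omega r \<Longrightarrow> act (cst c * x) h = cst c * act x h"
    using linear_maps_D(2)[OF lin, of x c] by (simp add: Omega_cst_mult)
qed

lemma hecke_action_one: "is_hecke_action n q r act \<Longrightarrow> x \<in> Omega r \<Longrightarrow> act x \<one>\<^bsub>H_affine r q\<^esub> = x"
  by (simp add: is_hecke_action_def is_right_module_def)

lemma hecke_action_mult:
  "is_hecke_action n q r act \<Longrightarrow> x \<in> Omega r \<Longrightarrow> h \<in> carrier (H_affine r q) \<Longrightarrow> k \<in> carrier (H_affine r q)
    \<Longrightarrow> act x (h \<otimes>\<^bsub>H_affine r q\<^esub> k) = act (act x h) k"
  by (simp add: is_hecke_action_def is_right_module_def)

lemma hecke_action_smult: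
  "is_hecke_action n q r act \<Longrightarrow> x \<in> Omega r \<Longrightarrow> h \<in> carrier (H_affine r q)
    \<Longrightarrow> act x (c \<odot>\<^bsub>H_affine r q\<^esub> h) = cst c * act x h"
  by (simp add: is_hecke_action_def is_right_module_def)

lemma hecke_action_T:
  assumes act: "is_hecke_action n q r act" and k: "k \<in> {1..<r}" and v: "v \<in> Omega_fin n r"
  shows "act v (hg r q (HT k)) = T_op q k v"
proof (rule linear_eq_on_Omega_fin[OF v])
  show "act (mon w) (hg r q (HT k)) = T_op q k (mon w)" if "w \<in> fin_words n r" for w
    using that act k by (simp add: is_hecke_action_def fin_words_def T_op_def)
  have h: "hg r q (HT k) \<in> carrier (H_affine r q)" using k by (simp add: hg_closed)
  show "act (x + y) (hg r q (HT k)) = act x (hg r q (HT k)) + act y (hg r q (HT k))"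
    if "x \<in> Omega_fin n r" "y \<in> Omega_fin n r" for x y
    using that hecke_action_linear(1)[OF act h] Omega_fin_subset by blast
  show "act (cst c * x) (hg r q (HT k)) = cst c * act x (hg r q (HT k))" if "x \<in> Omega_fin n r" for c x
    using that hecke_action_linear(2)[OF act h] Omega_fin_subset by blast
qed (simp_all add: T_op_def lin_ext_add lin_ext_scale)

lemma hecke_action_T_prod:
  assumes act: "is_hecke_action n q r act" and "set ks \<subseteq> {1..<r}" "v \<in> Omega_fin n r"
  shows "act v (alg_prod (H_affine r q) (map (\<lambda>k. hg r q (HT k)) ks)) = fold (T_op q) ks v"
  using assms(2,3)
proof (induction ks arbitrary: v)
  case Nil
  then show ?case
    using hecke_action_one[OF act, of v] Omega_fin_subset[of n r] by (auto simp: alg_prod_def)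
next
  case (Cons k ks)
  let ?h = "alg_prod (H_affine r q) (map (\<lambda>k. hg r q (HT k)) ks)"
  have "?h \<in> carrier (H_affine r q)"
    by (rule T_prod_closed) (use Cons.prems in simp)
  moreover have "v \<in> Omega r" using Cons.prems Omega_fin_subset by blast
  ultimately have "act v (alg_prod (H_affine r q) (map (\<lambda>k. hg r q (HT k)) (k # ks)))
    = act (act v (hg r q (HT k))) ?h"
    using Cons.prems hg_closed[of "HT k" r q]
    by (simp add: alg_prod_def hecke_action_mult[OF act])
  then show ?case
    using Cons T_op_in_Omega_fin[of v n r k q] by (simp add: hecke_action_T[OF act])
qed

text \<open>The action is prescribed for \<open>X\<^sub>t\<^sup>-\<^sup>1\<close> only; the relation \<open>X\<^sub>t\<^sup>-\<^sup>1X\<^sub>t = 1\<close> gives that of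
  \<open>X\<^sub>t\<close>. List positions start at \<open>0\<close>, so position \<open>t\<close> belongs to \<open>X\<^bsub>t+1\<^esub>\<close>.\<close>

lemma hecke_action_X:
  assumes act: "is_hecke_action n q r act" and "t < r" "length s = r"
  shows "act (mon (s[t := s ! t + int n])) (hg r q (HX (Suc t))) = mon s"
proof -
  have gens: "HX (Suc t) \<in> H_gens r" "HXi (Suc t) \<in> H_gens r" using assms by simp_all
  have "var (HXi (Suc t)) * var (HX (Suc t)) - 1 \<in> {var (HXi i) * var (HX i) - 1 | i. i \<in> {1..r}}"
    using \<open>t < r\<close> by auto
  then have "var (HXi (Suc t)) * var (HX (Suc t)) - 1 \<in> H_rels r q"
    unfolding H_rels_def Un_iff by blast
  then have inv: "hg r q (HXi (Suc t)) \<otimes>\<^bsub>H_affine r q\<^esub> hg r q (HX (Suc t)) = \<one>\<^bsub>H_affine r q\<^esub>"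
    using presentation.pgen_inverse[OF H_presentation gens(2,1)] by (simp add: H_affine_def)
  have s: "mon s \<in> Omega r" using assms by (simp add: Omega_eq)
  have "act (mon s) (hg r q (HXi (Suc t))) = mon (s[t := s ! t + int n])"
    using act assms(2,3) by (simp add: is_hecke_action_def)
  then have "act (mon (s[t := s ! t + int n])) (hg r q (HX (Suc t)))
    = act (mon s) (hg r q (HXi (Suc t)) \<otimes>\<^bsub>H_affine r q\<^esub> hg r q (HX (Suc t)))"
    using s hg_closed[OF gens(1)] hg_closed[OF gens(2)] by (simp add: hecke_action_mult[OF act])
  then show ?thesis
    using s by (simp add: inv hecke_action_one[OF act])
qed

text \<open>A letter \<open>0\<close> at some position is a letter \<open>n\<close> acted upon by the \<open>X\<close> of that position, and
  \<open>\<epsilon>\<close> replaces this \<open>X\<close> by its evaluation. As \<open>n\<close> is the largest letter,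
  \<open>fold_T_op_evaluated_X\<close> applies.\<close>

lemma eps_mon_zero:
  assumes act: "is_hecke_action n q r act" and ev: "is_ev r q a ev" and eps: "is_eps n q r act ev \<epsilon>"
    and "q \<noteq> 0" and uv: "u @ int n # v \<in> fin_words n r"
  shows "\<epsilon> (mon (u @ 0 # v))
    = cst (a * inverse q ^ length u * q ^ count_list u (int n)) * (carry q (int n) u * mon v)"
proof -
  let ?t = "length u" and ?H = "H_affine r q"
  let ?ks = "rev [1..<Suc ?t] @ [1..<Suc ?t]"
  let ?P = "alg_prod ?H (map (\<lambda>k. hg r q (HT k)) ?ks)"
  have t: "?t < r" "length (u @ 0 # v) = r" using uv by (auto simp: fin_words_def)
  have fin: "mon (u @ int n # v) \<in> Omega_fin n r" using uv by (simp add: Omega_fin_eq)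
  then have inf: "mon (u @ int n # v) \<in> Omega r" using Omega_fin_subset by blast
  have X: "hg r q (HX (Suc ?t)) \<in> carrier ?H" using t by (simp add: hg_closed)
  have ks: "set ?ks \<subseteq> {1..<r}" using t by auto
  have P: "?P \<in> carrier ?H"
    by (rule T_prod_closed[OF ks])
  have evX: "ev (hg r q (HX (Suc ?t))) = (a * inverse q ^ (2 * ?t)) \<odot>\<^bsub>?H\<^esub> ?P"
  proof -
    have "q powi (- 2 * (int (Suc ?t) - 1)) = inverse q ^ (2 * ?t)"
      by (simp add: power_int_minus power_int_def nat_mult_distrib power_inverse)
    moreover have "ev (hg r q (HX (Suc ?t))) = (a * q powi (- 2 * (int (Suc ?t) - 1))) \<odot>\<^bsub>?H\<^esub>
          alg_prod ?H (map (\<lambda>k. hg r q (HT k)) (rev [1..<Suc ?t]) @ map (\<lambda>k. hg r q (HT k)) [1..<Suc ?t])"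
      using ev t unfolding is_ev_def Let_def by (metis Suc_leI atLeastAtMost_iff le_add1 plus_1_eq_Suc)
    ultimately show ?thesis by (simp only: map_append)
  qed
  have "mon (u @ 0 # v) = act (mon (u @ int n # v)) (hg r q (HX (Suc ?t)))"
    using hecke_action_X[OF act t] by (simp add: nth_append list_update_append)
  then have "\<epsilon> (mon (u @ 0 # v)) = act (mon (u @ int n # v)) (ev (hg r q (HX (Suc ?t))))"
    using eps fin X by (simp add: is_eps_def)
  also have "\<dots> = cst (a * inverse q ^ (2 * ?t)) * act (mon (u @ int n # v)) ?P"
    unfolding evX by (rule hecke_action_smult[OF act inf P])
  also have "act (mon (u @ int n # v)) ?P = fold (T_op q) ?ks (mon (u @ int n # v))"
    by (rule hecke_action_T_prod[OF act ks fin])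
  also have "\<dots> = cst (q ^ (?t + count_list u (int n))) * (carry q (int n) u * mon v)"
    by (rule fold_T_op_evaluated_X) (use uv in \<open>auto simp: fin_words_def\<close>)
  also have "cst (a * inverse q ^ (2 * ?t)) * \<dots>
      = cst (a * inverse q ^ (2 * ?t) * q ^ (?t + count_list u (int n))) * (carry q (int n) u * mon v)"
    by (simp add: cst_mult mult.assoc)
  also have "a * inverse q ^ (2 * ?t) * q ^ (?t + count_list u (int n))
      = a * inverse q ^ ?t * q ^ count_list u (int n)"
    using \<open>q \<noteq> 0\<close> by (simp add: power_add mult_2 flip: power_inverse) (simp add: power_add[symmetric] field_simps)
  finally show ?thesis .
qed

lemma linear_maps_sum:
  assumes f: "f \<in> linear_maps (Omega r) W" and "\<And>i. i \<in> I \<Longrightarrow> g i \<in> Omega r"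
  shows "f (\<Sum>i\<in>I. cst (c i) * g i) = (\<Sum>i\<in>I. cst (c i) * f (g i))"
proof -
  have zero: "f 0 = 0" using linear_maps_D(2)[OF f Omega_zero, of 0] by simp
  have "(\<Sum>i\<in>I. cst (c i) * g i) \<in> Omega r
    \<and> f (\<Sum>i\<in>I. cst (c i) * g i) = (\<Sum>i\<in>I. cst (c i) * f (g i))"
    using assms(2)
  proof (induction I rule: infinite_finite_induct)
    case (insert i I)
    then show ?case
      using linear_maps_D(1)[OF f, of "cst (c i) * g i" "\<Sum>i\<in>I. cst (c i) * g i"]
        linear_maps_D(2)[OF f, of "g i" "c i"]
      by (simp add: Omega_add Omega_cst_mult)
  qed (simp_all add: zero Omega_zero)
  then show ?thesis ..
qed

text \<open>In the summand for \<open>w = u 1 v\<close> the letters \<open>n\<close> of \<open>v\<close> are counted by \<open>K\<^sub>n\<close> in the coproduct of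
  \<open>E\<^sub>n\<close>, and those of \<open>u\<close> by the evaluation of \<open>X\<close>. Together they give a power of \<open>q\<close> that does not
  depend on the summand and can be taken out of the sum.\<close>

lemma eps_zeta_E_last:
  assumes \<zeta>: "is_zeta_affine n q r \<zeta>" and act: "is_hecke_action n q r act"
    and ev: "is_ev r q a ev" and eps: "is_eps n q r act ev \<epsilon>"
    and "n \<ge> 2" "q \<noteq> 0" and w: "w \<in> fin_words n r"
  shows "\<epsilon> (\<zeta> (dg n q (GE (int n))) (mon w)) = cst (a * q ^ count_list w (int n)) * carry_sum q 1 (int n) w"
proof -
  let ?N = "int n"
  let ?c = "\<lambda>t. if w ! t = 1 then q ^ count_list (drop (Suc t) w) ?N
       * inverse q ^ count_list (drop (Suc t) w) 1 else 0"
  have len: "length w = r" and set: "set w \<subseteq> {1..?N}" using w by (auto simp: fin_words_def)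
  have lin: "\<epsilon> \<in> linear_maps (Omega r) (Omega_fin n r)" using eps by (simp add: is_eps_def)
  have summand: "cst (?c t) * \<epsilon> (mon (take t w @ 0 # drop (Suc t) w))
      = cst (a * q ^ count_list w ?N) * (cst (if w ! t = 1 then inverse q ^ (count_list (drop (Suc t) w) 1 + t) else 0)
        * (carry q ?N (take t w) * mon (drop (Suc t) w)))" if "t < r" for t
  proof (cases "w ! t = 1")
    case True
    have split: "w = take t w @ 1 # drop (Suc t) w"
      by (rule id_take_nth_drop[of t w, unfolded True]) (use that len in simp)
    have count: "count_list w ?N = count_list (take t w) ?N + count_list (drop (Suc t) w) ?N"
      using \<open>n \<ge> 2\<close> by (subst split) (simp del: append_take_drop_id)
    have "take t w @ ?N # drop (Suc t) w \<in> fin_words n r"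
      using that len set \<open>n \<ge> 2\<close> set_take_subset[of t w] set_drop_subset[of "Suc t" w]
      by (auto simp: fin_words_def)
    then have "\<epsilon> (mon (take t w @ 0 # drop (Suc t) w))
      = cst (a * inverse q ^ t * q ^ count_list (take t w) ?N) * (carry q ?N (take t w) * mon (drop (Suc t) w))"
      using eps_mon_zero[OF act ev eps \<open>q \<noteq> 0\<close>] that len by simp
    moreover have "q ^ count_list (drop (Suc t) w) ?N * inverse q ^ count_list (drop (Suc t) w) 1
        * (a * inverse q ^ t * q ^ count_list (take t w) ?N)
      = a * q ^ count_list w ?N * inverse q ^ (count_list (drop (Suc t) w) 1 + t)"
      unfolding count power_add by (simp only: mult_ac)
    ultimately show ?thesis
      using True by (simp only: cst_cst_mult if_True refl)
  qed simp
  have "\<zeta> (dg n q (GE ?N)) (mon w) = (\<Sum>t<r. cst (?c t) * mon (take t w @ 0 # drop (Suc t) w))"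
    using gen_act_E_last[OF \<open>n \<ge> 2\<close> set, of q] is_zeta_affine_gen[OF \<zeta>, of "GE ?N" "mon w"] len \<open>n \<ge> 2\<close>
    by (simp add: Omega_eq)
  then have "\<epsilon> (\<zeta> (dg n q (GE ?N)) (mon w)) = (\<Sum>t<r. cst (?c t) * \<epsilon> (mon (take t w @ 0 # drop (Suc t) w)))"
    using linear_maps_sum[OF lin, of "{..<r}" "\<lambda>t. mon (take t w @ 0 # drop (Suc t) w)" ?c] len
    by (simp add: Omega_eq)
  also have "\<dots> = cst (a * q ^ count_list w ?N) * carry_sum q 1 ?N w"
    unfolding carry_sum_def sum_distrib_left len by (rule sum.cong) (simp_all only: summand lessThan_iff)
  finally show ?thesis .
qed

lemma U_affine_gen:
  "g \<in> (\<Union>i\<in>{1..int n}. {GE i, GF i, GK i, GKi i}) \<Longrightarrow> dg n q g \<in> carrier (U_affine n q)"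
  by (auto simp: U_affine_def generated_subalgebra_def)

lemma U_fin_subset:
  assumes "n \<ge> 1"
  shows "carrier (U_fin n q) \<subseteq> carrier (D_alg n q)"
proof -
  interpret presentation "D_gens n" "D_rels n q" by (rule D_presentation[OF assms])
  interpret D: ring "D_alg n q" unfolding D_alg_def by (rule ring_presented)
  have "subring (carrier (D_alg n q)) (D_alg n q)" by (rule D.carrier_is_subring)
  then have "is_subalgebra (carrier (D_alg n q)) (D_alg n q)"
    using smult_closed by (simp add: is_subalgebra_def D_alg_def)
  moreover have "dg n q ` ((\<Union>i\<in>{1..<int n}. {GE i, GF i}) \<union> (\<Union>j\<in>{1..int n}. {GK j, GKi j}))
      \<subseteq> carrier (D_alg n q)"
    by (auto simp: D_alg_def intro!: pgen_closed)
  ultimately show ?thesis unfolding U_fin_def generated_subalgebra_def by auto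
qed

theorem proposition5p4:
  fixes n r :: nat and q a :: complex
    and \<zeta> :: "dgen free set \<Rightarrow> tensor \<Rightarrow> tensor"
    and act :: "tensor \<Rightarrow> hgen free set \<Rightarrow> tensor"
    and Ev :: "dgen free set \<Rightarrow> dgen free set"
    and ev :: "hgen free set \<Rightarrow> hgen free set"
    and \<epsilon> :: "tensor \<Rightarrow> tensor"
  assumes "n \<ge> 2" and "r \<ge> 1"
    and "q \<noteq> 0" and "\<And>k::nat. k \<ge> 1 \<Longrightarrow> q ^ k \<noteq> 1"
    and "a \<noteq> 0"
    and "is_zeta_affine n q r \<zeta>"
    and "is_hecke_action n q r act"
    and "is_Ev n q a Ev"
    and "is_ev r q a ev"
    and "is_eps n q r act ev \<epsilon>"
  shows "(zeta_fin n r \<zeta> \<circ> Ev) (dg n q (GE (int n))) \<in> schur_fin n q r \<zeta>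
    \<and> (zeta_fin n r \<zeta> \<circ> Ev) (dg n q (GE (int n)))
       = (ev_tilde n r \<epsilon> \<circ> \<zeta>) (dg n q (GE (int n)))"
proof
  let ?E = "dg n q (GE (int n))"
  have hom: "\<zeta> \<in> alg_hom (D_alg n q) (End_alg (Omega r))"
    using assms by (simp add: is_zeta_affine_def)
  have "Ev \<in> alg_hom (U_affine n q) (U_fin n q)" using assms by (simp add: is_Ev_def Let_def)
  moreover have "?E \<in> carrier (U_affine n q)" by (rule U_affine_gen) (use assms(1) in auto)
  ultimately have EvE: "Ev ?E \<in> carrier (U_fin n q)" by (auto simp: alg_hom_def ring_hom_def)
  then show "(zeta_fin n r \<zeta> \<circ> Ev) ?E \<in> schur_fin n q r \<zeta>" by (simp add: schur_fin_def)
  have "Ev ?E \<in> carrier (D_alg n q)" using EvE U_fin_subset[of n q] assms(1) by auto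
  then have L: "\<zeta> (Ev ?E) \<in> linear_maps (Omega r) (Omega r)" by (rule alg_hom_End_linear[OF hom])
  have "?E \<in> carrier (D_alg n q)"
    using presentation.pgen_closed[OF D_presentation, of n "GE (int n)" q] assms(1) by (simp add: D_alg_def)
  then have E: "\<zeta> ?E \<in> linear_maps (Omega r) (Omega r)" by (rule alg_hom_End_linear[OF hom])
  have eps: "\<epsilon> \<in> linear_maps (Omega r) (Omega_fin n r)" using assms by (simp add: is_eps_def)
  have "\<zeta> (Ev ?E) x = \<epsilon> (\<zeta> ?E x)" if x: "x \<in> Omega_fin n r" for x
  proof (rule linear_eq_on_Omega_fin[OF x])
    show "\<zeta> (Ev ?E) (mon w) = \<epsilon> (\<zeta> ?E (mon w))" if "w \<in> fin_words n r" for w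
      using zeta_Ev_E_last[of n q r \<zeta> a Ev w] eps_zeta_E_last[of n q r \<zeta> act a ev \<epsilon> w] that assms by simp
  qed (use Omega_fin_subset[of n r] linear_maps_D(1,2)[OF L] linear_maps_D[OF E] linear_maps_D(1,2)[OF eps]
      in \<open>simp_all add: subset_eq\<close>)
  then show "(zeta_fin n r \<zeta> \<circ> Ev) ?E = (ev_tilde n r \<epsilon> \<circ> \<zeta>) ?E"
    by (auto simp: zeta_fin_def ev_tilde_def)
qed

end
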